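(* Let $G$ be a locally compact group. Then $L^{1}(G)$, regarded as a Banach left $L^{1}(G)$-module, is 0-injective if and only if $G$ is discrete.
   Context: $L^1(G)$ is the group algebra of $G$ (with respect to left Haar measure) with convolution product, and it is a left module over itself by convolution. For a Banach algebra $A$, let $A\textbf{-mod}$ denote the category of all Banach left $A$-modules. For $E,F\in A\textbf{-mod}$, $B(E,F)$ denotes the bounded linear operators from $E$ to $F$, and ${}_{A}B(E,F)$ denotes the space of all bounded linear left $A$-module morphisms from $E$ into $F$. For Banach spaces $E,F$, an operator $T\in B(E,F)$ is admissible if there exists $S\in B(F,E)$ with $T\circ S\circ T=T$. A monomorphism in $A\textbf{-mod}$ is an injective element of ${}_{A}B(F,K)$. A module $E\in A\textbf{-mod}$ is called (left) 0-injective if for all $F,K\in A\textbf{-mod}$ and every admissible monomorphism $T\in {}_{A}B(F,K)$ with $A\cdot K=\mathrm{span}\{a\cdot k: a\in A,\ k\in K\}\subseteq \mathrm{Im}\,T$, the induced map $T_{E}:{}_{A}B(K,E)\to {}_{A}B(F,E)$, $T_{E}(R)=R\circ T$, is onto. *)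

theory Defs
  imports "HOL-Analysis.Analysis" "HOL-Algebra.Module"
begin

section \<open>Complex Banach spaces on carrier sets\<close>

text \<open>
  The definition of 0-injectivity quantifies over all Banach modules, so Banach spaces are
  records with a carrier set rather than types of class \<open>banach\<close>. As in the locale
  \<open>Module.module\<close>, the fields \<open>mult\<close> and \<open>one\<close> of the ring record carry no information for
  a mere vector space; a Banach algebra uses \<open>mult\<close>, and since it need not be unital the
  field \<open>one\<close> is never used.
\<close>

definition complex_ring :: "complex ring"
  where "complex_ring = \<lparr>carrier = UNIV, mult = (*), one = 1, zero = 0, add = (+)\<rparr>"

record 'v normed_module = "(complex, 'v) module" +
  nrm :: "'v \<Rightarrow> real"

text \<open>The value off the carrier only serves to meet the axioms of \<open>Metric_space\<close>, which
  constrain the distance function on the whole type.\<close>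

definition nrm_dist :: "('v, 'm) normed_module_scheme \<Rightarrow> 'v \<Rightarrow> 'v \<Rightarrow> real"
  where "nrm_dist V x y =
    (if x \<in> carrier V \<and> y \<in> carrier V then nrm V (x \<ominus>\<^bsub>V\<^esub> y) else 0)"

locale complex_banach_space = vec?: Module.module complex_ring V for V (structure) +
  assumes nrm_nonneg: "x \<in> carrier V \<Longrightarrow> 0 \<le> nrm V x"
    and nrm_eq_0_iff: "x \<in> carrier V \<Longrightarrow> nrm V x = 0 \<longleftrightarrow> x = \<zero>"
    and nrm_smult: "x \<in> carrier V \<Longrightarrow> nrm V (c \<odot> x) = cmod c * nrm V x"
    and nrm_triangle: "\<lbrakk>x \<in> carrier V; y \<in> carrier V\<rbrakk> \<Longrightarrow> nrm V (x \<oplus> y) \<le> nrm V x + nrm V y"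
    and complete: "Metric_space.mcomplete (carrier V) (nrm_dist V)"

definition vspan :: "('v, 'm) normed_module_scheme \<Rightarrow> 'v set \<Rightarrow> 'v set"
  where "vspan V S = (\<lambda>H. submodule H complex_ring V) hull S"

text \<open>Operators are extensional functions, so that equality of operators is equality of
  functions and \<open>compose\<close> is their composition.\<close>

definition bounded_ops ::
  "('v, 'm) normed_module_scheme \<Rightarrow> ('w, 'n) normed_module_scheme \<Rightarrow> ('v \<Rightarrow> 'w) set"
  where "bounded_ops E F = {T \<in> carrier E \<rightarrow>\<^sub>E carrier F.
    (\<forall>x\<in>carrier E. \<forall>y\<in>carrier E. T (x \<oplus>\<^bsub>E\<^esub> y) = T x \<oplus>\<^bsub>F\<^esub> T y) \<and>
    (\<forall>c. \<forall>x\<in>carrier E. T (c \<odot>\<^bsub>E\<^esub> x) = c \<odot>\<^bsub>F\<^esub> T x) \<and>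
    (\<exists>C. \<forall>x\<in>carrier E. nrm F (T x) \<le> C * nrm E x)}"

definition admissible ::
  "('v, 'm) normed_module_scheme \<Rightarrow> ('w, 'n) normed_module_scheme \<Rightarrow> ('v \<Rightarrow> 'w) \<Rightarrow> bool"
  where "admissible E F T \<longleftrightarrow> T \<in> bounded_ops E F \<and>
    (\<exists>S\<in>bounded_ops F E. compose (carrier E) T (compose (carrier E) S T) = T)"

section \<open>Banach algebras and Banach left modules\<close>

locale complex_banach_algebra = complex_banach_space A for A (structure) +
  assumes mult_closed: "\<lbrakk>a \<in> carrier A; b \<in> carrier A\<rbrakk> \<Longrightarrow> a \<otimes> b \<in> carrier A"
    and mult_assoc: "\<lbrakk>a \<in> carrier A; b \<in> carrier A; c \<in> carrier A\<rbrakk>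
      \<Longrightarrow> (a \<otimes> b) \<otimes> c = a \<otimes> (b \<otimes> c)"
    and mult_distr_l: "\<lbrakk>a \<in> carrier A; b \<in> carrier A; c \<in> carrier A\<rbrakk>
      \<Longrightarrow> (a \<oplus> b) \<otimes> c = a \<otimes> c \<oplus> b \<otimes> c"
    and mult_distr_r: "\<lbrakk>a \<in> carrier A; b \<in> carrier A; c \<in> carrier A\<rbrakk>
      \<Longrightarrow> a \<otimes> (b \<oplus> c) = a \<otimes> b \<oplus> a \<otimes> c"
    and mult_smult_l: "\<lbrakk>a \<in> carrier A; b \<in> carrier A\<rbrakk> \<Longrightarrow> (z \<odot> a) \<otimes> b = z \<odot> (a \<otimes> b)"
    and mult_smult_r: "\<lbrakk>a \<in> carrier A; b \<in> carrier A\<rbrakk> \<Longrightarrow> a \<otimes> (z \<odot> b) = z \<odot> (a \<otimes> b)"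
    and nrm_mult: "\<lbrakk>a \<in> carrier A; b \<in> carrier A\<rbrakk> \<Longrightarrow> nrm A (a \<otimes> b) \<le> nrm A a * nrm A b"

record ('a, 'v) left_module = "'v normed_module" +
  act :: "'a \<Rightarrow> 'v \<Rightarrow> 'v"

locale banach_left_module = alg?: complex_banach_algebra A + complex_banach_space E
  for A :: "('a, 'm) normed_module_scheme" (structure)
    and E :: "('a, 'v, 'n) left_module_scheme" (structure) +
  assumes act_closed: "\<lbrakk>a \<in> carrier A; x \<in> carrier E\<rbrakk> \<Longrightarrow> act E a x \<in> carrier E"
    and act_assoc: "\<lbrakk>a \<in> carrier A; b \<in> carrier A; x \<in> carrier E\<rbrakk>
      \<Longrightarrow> act E (a \<otimes>\<^bsub>A\<^esub> b) x = act E a (act E b x)"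
    and act_distr_l: "\<lbrakk>a \<in> carrier A; b \<in> carrier A; x \<in> carrier E\<rbrakk>
      \<Longrightarrow> act E (a \<oplus>\<^bsub>A\<^esub> b) x = act E a x \<oplus>\<^bsub>E\<^esub> act E b x"
    and act_distr_r: "\<lbrakk>a \<in> carrier A; x \<in> carrier E; y \<in> carrier E\<rbrakk>
      \<Longrightarrow> act E a (x \<oplus>\<^bsub>E\<^esub> y) = act E a x \<oplus>\<^bsub>E\<^esub> act E a y"
    and act_smult_l: "\<lbrakk>a \<in> carrier A; x \<in> carrier E\<rbrakk>
      \<Longrightarrow> act E (z \<odot>\<^bsub>A\<^esub> a) x = z \<odot>\<^bsub>E\<^esub> act E a x"
    and act_smult_r: "\<lbrakk>a \<in> carrier A; x \<in> carrier E\<rbrakk>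
      \<Longrightarrow> act E a (z \<odot>\<^bsub>E\<^esub> x) = z \<odot>\<^bsub>E\<^esub> act E a x"
    and act_bounded: "\<exists>C. \<forall>a\<in>carrier A. \<forall>x\<in>carrier E. nrm E (act E a x) \<le> C * nrm A a * nrm E x"

definition regular_module :: "'a normed_module \<Rightarrow> ('a, 'a) left_module"
  where "regular_module A = normed_module.extend A (left_module.fields (mult A))"

definition module_ops ::
  "('a, 'm) normed_module_scheme \<Rightarrow> ('a, 'v, 'n) left_module_scheme
    \<Rightarrow> ('a, 'w, 'o) left_module_scheme \<Rightarrow> ('v \<Rightarrow> 'w) set"
  where "module_ops A E F = {T \<in> bounded_ops E F.
    \<forall>a\<in>carrier A. \<forall>x\<in>carrier E. T (act E a x) = act F a (T x)}"

definition action_span ::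
  "('a, 'm) normed_module_scheme \<Rightarrow> ('a, 'v, 'n) left_module_scheme \<Rightarrow> 'v set"
  where "action_span A K = vspan K {act K a k | a k. a \<in> carrier A \<and> k \<in> carrier K}"

text \<open>
  The modules \<open>F\<close> and \<open>K\<close> range over all Banach left \<open>A\<close>-modules whose carrier is a subset of
  the type \<open>'u\<close>. HOL cannot quantify over types inside a definition, so \<open>'u\<close> is a parameter
  and plays the role of a universe. Statements that use \<open>zero_injective\<close> keep \<open>'u\<close> arbitrary and
  at most require it to be large: over a small type, such as a singleton, the condition is void.
\<close>

definition zero_injective ::
  "'u itself \<Rightarrow> ('a, 'm) normed_module_scheme \<Rightarrow> ('a, 'v, 'n) left_module_scheme \<Rightarrow> bool"
  where "zero_injective U A E \<longleftrightarrow> banach_left_module A E \<and>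
    (\<forall>(F :: ('a, 'u) left_module) (K :: ('a, 'u) left_module) T.
      banach_left_module A F \<and> banach_left_module A K \<and>
      T \<in> module_ops A F K \<and> inj_on T (carrier F) \<and> admissible F K T \<and>
      action_span A K \<subseteq> T ` carrier F \<longrightarrow>
      (\<lambda>R. compose (carrier F) R T) ` module_ops A K E = module_ops A F E)"

section \<open>The group algebra\<close>

text \<open>
  Groups are types of class \<open>topological_group_add\<close>, which does not assume commutativity:
  the group operation is written \<open>x + y\<close>, the unit \<open>0\<close> and the inverse \<open>- x\<close>.
  A left Haar measure is a nonzero left-invariant Radon measure on the Borel sets, where Radon
  means finite on compact sets, outer regular on Borel sets and inner regular on open sets.
\<close>

definition left_haar_measure :: "'g :: {topological_group_add, t2_space} measure \<Rightarrow> bool"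
  where "left_haar_measure \<mu> \<longleftrightarrow>
    sets \<mu> = sets borel \<and>
    (\<forall>K. compact K \<longrightarrow> emeasure \<mu> K < \<infinity>) \<and>
    (\<forall>A\<in>sets borel. emeasure \<mu> A = (INF U\<in>{U. open U \<and> A \<subseteq> U}. emeasure \<mu> U)) \<and>
    (\<forall>U. open U \<longrightarrow> emeasure \<mu> U = (SUP K\<in>{K. compact K \<and> K \<subseteq> U}. emeasure \<mu> K)) \<and>
    emeasure \<mu> UNIV \<noteq> 0 \<and>
    (\<forall>a. \<forall>A\<in>sets borel. emeasure \<mu> ((+) a ` A) = emeasure \<mu> A)"

definition L1_rel :: "'g measure \<Rightarrow> (('g \<Rightarrow> complex) \<times> ('g \<Rightarrow> complex)) set"
  where "L1_rel \<mu> = {(f, g). integrable \<mu> f \<and> integrable \<mu> g \<and> (AE x in \<mu>. f x = g x)}"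

abbreviation L1_class :: "'g measure \<Rightarrow> ('g \<Rightarrow> complex) \<Rightarrow> ('g \<Rightarrow> complex) set"
  where "L1_class \<mu> f \<equiv> L1_rel \<mu> `` {f}"

text \<open>In multiplicative notation this is \<open>(f * g)(x) = \<integral> f(y) g(y\<inverse>x) dy\<close>; it is 0
  at the (null set of) points where the integrand is not integrable.\<close>

definition convolution ::
  "'g :: group_add measure \<Rightarrow> ('g \<Rightarrow> complex) \<Rightarrow> ('g \<Rightarrow> complex) \<Rightarrow> 'g \<Rightarrow> complex"
  where "convolution \<mu> f g x = (\<integral>y. f y * g (- y + x) \<partial>\<mu>)"

definition L1 :: "'g :: group_add measure \<Rightarrow> ('g \<Rightarrow> complex) set normed_module"
  where "L1 \<mu> = \<lparr>
    carrier = {f. integrable \<mu> f} // L1_rel \<mu>,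
    mult = (\<lambda>X Y. \<Union>f\<in>X. \<Union>g\<in>Y. L1_class \<mu> (convolution \<mu> f g)),
    one = undefined,
    zero = L1_class \<mu> (\<lambda>_. 0),
    add = (\<lambda>X Y. \<Union>f\<in>X. \<Union>g\<in>Y. L1_class \<mu> (\<lambda>x. f x + g x)),
    smult = (\<lambda>c X. \<Union>f\<in>X. L1_class \<mu> (\<lambda>x. c * f x)),
    nrm = (\<lambda>X. the_elem ((\<lambda>f. \<integral>x. cmod (f x) \<partial>\<mu>) ` X))\<rparr>"

end

theory Submission
  imports Defs
begin

text \<open>
  If \<open>L\<^sup>1(G)\<close> is 0-injective, then the identity of \<open>L\<^sup>1(G)\<close> extends to its unitization, and the
  image of the adjoined unit is a right identity \<open>e\<close>. Approximate \<open>e\<close> within \<open>1/2\<close> by a bounded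
  function \<open>g\<close>. For small open \<open>U\<close> the convolution \<open>1\<^sub>U * g\<close> is bounded by \<open>\<mu>(U) sup \<bar>g\<bar>\<close> and lies
  within \<open>\<mu>(U)/2\<close> of \<open>1\<^sub>U * e = 1\<^sub>U\<close> in norm, so \<open>\<mu>(U)\<close> is bounded below. Hence points have
  positive mass, compact neighbourhoods are finite, and \<open>G\<close> is discrete. Conversely, for discrete
  \<open>G\<close> the algebra is unital, and a morphism on the image of an admissible \<open>T\<close> is extended by first
  multiplying with the identity, which maps into that image.
\<close>

text \<open>That convolution makes L1 a Banach algebra usually rests on Tonelli's theorem, which the
  Borel sets of G x G need not support. The forward direction never proves it: 0-injectivity
  includes that L1 is a Banach algebra, and these axioms replace the exchange of integrals. So 1_U *
  (g - e) is known only as some integrable class of norm at most \<mu>(U)/2, whereas 1_U * g has to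
  be an honest function that can be bounded pointwise. This is why g is drawn from functions whose
  convolutions with the 1_U are known to be integrable, built from indicators of compact sets, for
  which these convolutions are measures of overlaps. The converse needs the algebra axioms only for
  a multiple of counting measure, where sums can be exchanged.

  The unitization is a legitimate test module because a(x + z1) = ax + za lies in A, so all products
  stay in the image of A.

  A second obstacle is size: test modules live on the type \<open>'u\<close>, which is only known to
  hold a copy of L1. The unitization fits as well because L1 x C has the cardinality of L1.\<close>

section \<open>Norms and completeness on carrier sets\<close>

lemma complex_ring_simps [simp]:
  "carrier complex_ring = UNIV" "mult complex_ring = (*)" "one complex_ring = 1"
  "zero complex_ring = 0" "add complex_ring = (+)"
  by (simp_all add: complex_ring_def)

lemma cring_complex_ring: "cring complex_ring"
proof (rule cringI)
  show "abelian_group complex_ring"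
    by (rule abelian_groupI) (auto intro: add.left_inverse)
  show "comm_monoid complex_ring"
    by (rule comm_monoidI) auto
qed (auto simp: algebra_simps)

lemma complex_ring_minus [simp]: "\<ominus>\<^bsub>complex_ring\<^esub> z = - z"
proof -
  interpret cring complex_ring by (rule cring_complex_ring)
  show ?thesis by (rule minus_equality) auto
qed

locale complex_normed_space = vec?: Module.module complex_ring V for V (structure) +
  assumes nrm_nonneg: "x \<in> carrier V \<Longrightarrow> 0 \<le> nrm V x"
    and nrm_eq_0_iff: "x \<in> carrier V \<Longrightarrow> nrm V x = 0 \<longleftrightarrow> x = \<zero>"
    and nrm_smult: "x \<in> carrier V \<Longrightarrow> nrm V (c \<odot> x) = cmod c * nrm V x"
    and nrm_triangle: "\<lbrakk>x \<in> carrier V; y \<in> carrier V\<rbrakk> \<Longrightarrow> nrm V (x \<oplus> y) \<le> nrm V x + nrm V y"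
begin

lemma nrm_minus_commute:
  assumes "x \<in> carrier V" "y \<in> carrier V"
  shows "nrm V (x \<ominus> y) = nrm V (y \<ominus> x)"
proof -
  have "(- 1) \<odot> (y \<ominus> x) = \<ominus> (1 \<odot> (y \<ominus> x))"
    using smult_l_minus[of 1 "y \<ominus> x"] assms by simp
  also have "\<dots> = \<ominus> (y \<ominus> x)"
    using smult_one[of "y \<ominus> x"] assms by simp
  also have "\<dots> = x \<ominus> y"
    using assms by (simp add: a_minus_def M.minus_add M.a_comm)
  finally show ?thesis
    using nrm_smult[of "y \<ominus> x" "- 1"] assms by simp
qed

lemma right_minus_eq_zero:
  assumes "x \<in> carrier V" "y \<in> carrier V"
  shows "x \<ominus> y = \<zero> \<longleftrightarrow> x = y"
  by (metis assms M.a_inv_closed M.add.inv_equality M.minus_minus M.r_neg a_minus_def)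

lemma Metric_space_nrm_dist: "Metric_space (carrier V) (nrm_dist V)"
proof
  fix x y
  show "0 \<le> nrm_dist V x y"
    by (simp add: nrm_dist_def nrm_nonneg)
  show "nrm_dist V x y = nrm_dist V y x"
    by (simp add: nrm_dist_def nrm_minus_commute)
next
  fix x y assume "x \<in> carrier V" "y \<in> carrier V"
  then show "nrm_dist V x y = 0 \<longleftrightarrow> x = y"
    by (simp add: nrm_dist_def nrm_eq_0_iff right_minus_eq_zero)
next
  fix x y z assume xyz: "x \<in> carrier V" "y \<in> carrier V" "z \<in> carrier V"
  have "x \<ominus> z = (x \<ominus> y) \<oplus> (y \<ominus> z)"
  proof -
    have "(x \<ominus> y) \<oplus> (y \<ominus> z) = x \<oplus> (\<ominus> y \<oplus> (y \<oplus> \<ominus> z))"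
      using xyz by (simp add: a_minus_def M.a_assoc)
    also have "\<ominus> y \<oplus> (y \<oplus> \<ominus> z) = \<ominus> z"
      using xyz by (simp add: M.r_neg1)
    finally show ?thesis by (simp add: a_minus_def)
  qed
  then show "nrm_dist V x z \<le> nrm_dist V x y + nrm_dist V y z"
    using xyz nrm_triangle[of "x \<ominus> y" "y \<ominus> z"] by (simp add: nrm_dist_def)
qed

text \<open>Frees completeness from \<open>nrm_dist\<close> and its artificial value off the
  carrier; all later completeness proofs work with norms of differences.\<close>

lemma mcomplete_iff:
  "Metric_space.mcomplete (carrier V) (nrm_dist V) \<longleftrightarrow>
    (\<forall>s. (\<forall>n. s n \<in> carrier V) \<longrightarrow> (\<forall>\<epsilon>>0. \<exists>N. \<forall>m\<ge>N. \<forall>n\<ge>N. nrm V (s m \<ominus> s n) < \<epsilon>) \<longrightarrow>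
      (\<exists>x\<in>carrier V. (\<lambda>n. nrm V (s n \<ominus> x)) \<longlonglongrightarrow> 0))"
proof -
  interpret M: Metric_space "carrier V" "nrm_dist V"
    by (rule Metric_space_nrm_dist)
  have 1: "M.MCauchy s \<longleftrightarrow> (\<forall>n. s n \<in> carrier V) \<and>
      (\<forall>\<epsilon>>0. \<exists>N. \<forall>m\<ge>N. \<forall>n\<ge>N. nrm V (s m \<ominus> s n) < \<epsilon>)" for s
    unfolding M.MCauchy_def by (auto simp: nrm_dist_def image_subset_iff)
  have 2: "limitin M.mtopology s x sequentially \<longleftrightarrow> (\<lambda>n. nrm V (s n \<ominus> x)) \<longlonglongrightarrow> 0"
    if "x \<in> carrier V" "\<forall>n. s n \<in> carrier V" for s x
    using that
    by (simp add: M.limitin_metric_dist_null nrm_dist_def)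
  have 3: "x \<in> carrier V" if "limitin M.mtopology s x sequentially" for s x
    using that M.limitin_metric by blast
  show ?thesis
    proof
    assume L: M.mcomplete
    show "\<forall>s. (\<forall>n. s n \<in> carrier V) \<longrightarrow>
      (\<forall>\<epsilon>>0. \<exists>N. \<forall>m\<ge>N. \<forall>n\<ge>N. nrm V (s m \<ominus> s n) < \<epsilon>) \<longrightarrow>
      (\<exists>x\<in>carrier V. (\<lambda>n. nrm V (s n \<ominus> x)) \<longlonglongrightarrow> 0)"
    proof (intro allI impI)
      fix s :: "nat \<Rightarrow> 'a" assume s: "\<forall>n. s n \<in> carrier V"
        and "\<forall>\<epsilon>>0. \<exists>N. \<forall>m\<ge>N. \<forall>n\<ge>N. nrm V (s m \<ominus> s n) < \<epsilon>"
      with L obtain x where x: "limitin M.mtopology s x sequentially"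
        unfolding M.mcomplete_def 1 by blast
      with s show "\<exists>x\<in>carrier V. (\<lambda>n. nrm V (s n \<ominus> x)) \<longlonglongrightarrow> 0"
        using 2[OF 3[OF x] s] 3[OF x] by blast
    qed
  next
    assume R: "\<forall>s. (\<forall>n. s n \<in> carrier V) \<longrightarrow>
      (\<forall>\<epsilon>>0. \<exists>N. \<forall>m\<ge>N. \<forall>n\<ge>N. nrm V (s m \<ominus> s n) < \<epsilon>) \<longrightarrow>
      (\<exists>x\<in>carrier V. (\<lambda>n. nrm V (s n \<ominus> x)) \<longlonglongrightarrow> 0)"
    show M.mcomplete
      unfolding M.mcomplete_def 1
    proof (intro allI impI)
      fix s :: "nat \<Rightarrow> 'a" assume s: "(\<forall>n. s n \<in> carrier V) \<and>
        (\<forall>\<epsilon>>0. \<exists>N. \<forall>m\<ge>N. \<forall>n\<ge>N. nrm V (s m \<ominus> s n) < \<epsilon>)"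
      obtain x where x: "x \<in> carrier V" "(\<lambda>n. nrm V (s n \<ominus> x)) \<longlonglongrightarrow> 0"
        using R[THEN spec, THEN mp, THEN mp, OF conjunct1[OF s] conjunct2[OF s]] by blast
      have "limitin M.mtopology s x sequentially"
        by (rule 2[THEN iffD2, OF x(1) conjunct1[OF s] x(2)])
      then show "\<exists>x. limitin M.mtopology s x sequentially"
        by (rule exI)
    qed
  qed
qed

end

lemma (in complex_banach_space) complex_normed_space: "complex_normed_space V"
  by unfold_locales (auto simp: nrm_nonneg nrm_eq_0_iff nrm_smult nrm_triangle)

text \<open>The reason for isolating the norm axioms in \<open>complex_normed_space\<close>:
  \<open>mcomplete_iff\<close> must be usable while completeness is still being proved.\<close>

lemma complex_banach_spaceI:
  assumes "complex_normed_space V"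
    and "\<And>s. \<lbrakk>\<And>n. s n \<in> carrier V;
        \<And>\<epsilon>. 0 < \<epsilon> \<Longrightarrow> \<exists>N. \<forall>m\<ge>N. \<forall>n\<ge>N. nrm V (s m \<ominus>\<^bsub>V\<^esub> s n) < \<epsilon>\<rbrakk>
      \<Longrightarrow> \<exists>x\<in>carrier V. (\<lambda>n. nrm V (s n \<ominus>\<^bsub>V\<^esub> x)) \<longlonglongrightarrow> 0"
  shows "complex_banach_space V"
proof -
  interpret complex_normed_space V by fact
  show ?thesis
    apply unfold_locales
    apply (simp_all add: nrm_nonneg nrm_eq_0_iff nrm_smult nrm_triangle)
    unfolding mcomplete_iff
    by (intro allI impI assms(2)) simp_all
qed

text \<open>The additive inverse is demanded as \<open>(- 1) \<odot> x\<close>, so a concrete space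
  is checked with the operations of its record alone.\<close>

lemma complex_normed_spaceI:
  fixes V (structure)
  assumes "\<And>x y. \<lbrakk>x \<in> carrier V; y \<in> carrier V\<rbrakk> \<Longrightarrow> x \<oplus> y \<in> carrier V"
    and "\<zero> \<in> carrier V"
    and "\<And>c x. x \<in> carrier V \<Longrightarrow> c \<odot> x \<in> carrier V"
    and "\<And>x y z. \<lbrakk>x \<in> carrier V; y \<in> carrier V; z \<in> carrier V\<rbrakk> \<Longrightarrow> (x \<oplus> y) \<oplus> z = x \<oplus> (y \<oplus> z)"
    and "\<And>x y. \<lbrakk>x \<in> carrier V; y \<in> carrier V\<rbrakk> \<Longrightarrow> x \<oplus> y = y \<oplus> x"
    and "\<And>x. x \<in> carrier V \<Longrightarrow> \<zero> \<oplus> x = x"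
    and "\<And>x. x \<in> carrier V \<Longrightarrow> (- 1) \<odot> x \<oplus> x = \<zero>"
    and "\<And>b c x. x \<in> carrier V \<Longrightarrow> (b + c) \<odot> x = b \<odot> x \<oplus> c \<odot> x"
    and "\<And>c x y. \<lbrakk>x \<in> carrier V; y \<in> carrier V\<rbrakk> \<Longrightarrow> c \<odot> (x \<oplus> y) = c \<odot> x \<oplus> c \<odot> y"
    and "\<And>b c x. x \<in> carrier V \<Longrightarrow> (b * c) \<odot> x = b \<odot> (c \<odot> x)"
    and "\<And>x. x \<in> carrier V \<Longrightarrow> 1 \<odot> x = x"
    and "\<And>x. x \<in> carrier V \<Longrightarrow> 0 \<le> nrm V x"
    and "\<And>x. x \<in> carrier V \<Longrightarrow> nrm V x = 0 \<longleftrightarrow> x = \<zero>"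
    and "\<And>c x. x \<in> carrier V \<Longrightarrow> nrm V (c \<odot> x) = cmod c * nrm V x"
    and "\<And>x y. \<lbrakk>x \<in> carrier V; y \<in> carrier V\<rbrakk> \<Longrightarrow> nrm V (x \<oplus> y) \<le> nrm V x + nrm V y"
  shows "complex_normed_space V"
proof -
  have "abelian_group V"
  proof (rule abelian_groupI)
    fix x assume "x \<in> carrier V"
    then show "\<exists>y\<in>carrier V. y \<oplus> x = \<zero>"
      using assms(3,7) by blast
  qed (simp_all add: assms(1,2,4,6), simp add: assms(5))
  then have "Module.module complex_ring V"
    by (intro moduleI cring_complex_ring) (simp_all add: assms)
  then show ?thesis
    by (intro complex_normed_space.intro complex_normed_space_axioms.intro)
      (simp_all add: assms(12-))
qed

lemma (in complex_normed_space) minus_eq_add_smult: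
  assumes "x \<in> carrier V" "y \<in> carrier V"
  shows "x \<ominus> y = x \<oplus> (- 1) \<odot> y"
  using smult_l_minus[of 1 y] smult_one[of y] assms
  by (simp add: a_minus_def)

section \<open>Isometric copies\<close>

text \<open>Transport of structure. With \<open>\<phi> = id\<close> it passes between records that
  differ only in other fields; with an injection into \<open>'u\<close> it moves a space into the
  universe.\<close>

lemma complex_banach_space_copy:
  fixes V (structure) and W :: "('w, 'm) normed_module_scheme" and \<phi>
  assumes "complex_banach_space V"
    and car: "carrier W = \<phi> ` carrier V"
    and zero: "\<zero>\<^bsub>W\<^esub> = \<phi> \<zero>"
    and add: "\<And>x y. \<lbrakk>x \<in> carrier V; y \<in> carrier V\<rbrakk> \<Longrightarrow> \<phi> x \<oplus>\<^bsub>W\<^esub> \<phi> y = \<phi> (x \<oplus> y)"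
    and smult: "\<And>c x. x \<in> carrier V \<Longrightarrow> c \<odot>\<^bsub>W\<^esub> \<phi> x = \<phi> (c \<odot> x)"
    and nrm: "\<And>x. x \<in> carrier V \<Longrightarrow> nrm W (\<phi> x) = nrm V x"
    and inj: "inj_on \<phi> (carrier V)"
  shows "complex_banach_space W"
proof -
  interpret V: complex_banach_space V by fact
  interpret V: complex_normed_space V by (rule V.complex_normed_space)
  note [simp] = V.smult_closed[simplified] V.smult_one[simplified]
  note facts = add smult nrm zero V.a_assoc V.a_comm V.a_lcomm V.smult_l_distr[simplified]
    V.smult_r_distr[simplified] V.smult_assoc1[simplified] V.nrm_nonneg V.nrm_eq_0_iff
    V.nrm_smult V.nrm_triangle
  interpret W: complex_normed_space W
  proof (rule complex_normed_spaceI)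
    fix x assume "x \<in> carrier W"
    then show "(- 1) \<odot>\<^bsub>W\<^esub> x \<oplus>\<^bsub>W\<^esub> x = \<zero>\<^bsub>W\<^esub>"
      using V.smult_l_minus[of 1] by (auto simp: car facts V.r_neg)
    show "nrm W x = 0 \<longleftrightarrow> x = \<zero>\<^bsub>W\<^esub>"
      using \<open>x \<in> carrier W\<close> inj by (auto simp: car facts inj_on_eq_iff)
  qed (auto simp: car facts)
  have minus: "\<phi> x \<ominus>\<^bsub>W\<^esub> \<phi> y = \<phi> (x \<ominus> y)" if "x \<in> carrier V" "y \<in> carrier V" for x y
    using that by (simp add: W.minus_eq_add_smult V.minus_eq_add_smult car add smult)
  show ?thesis
  proof (rule complex_banach_spaceI)
    show "complex_normed_space W" ..
  next
    fix s :: "nat \<Rightarrow> 'w" assume s: "\<And>n. s n \<in> carrier W"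
      and cauchy: "\<And>\<epsilon>. 0 < \<epsilon> \<Longrightarrow> \<exists>N. \<forall>m\<ge>N. \<forall>n\<ge>N. nrm W (s m \<ominus>\<^bsub>W\<^esub> s n) < \<epsilon>"
    from s have "\<exists>t. \<forall>n. t n \<in> carrier V \<and> s n = \<phi> (t n)"
      unfolding car image_iff by (intro choice) blast
    then obtain t where t: "\<And>n. t n \<in> carrier V" "\<And>n. s n = \<phi> (t n)"
      by blast
    have "\<exists>N. \<forall>m\<ge>N. \<forall>n\<ge>N. nrm V (t m \<ominus> t n) < \<epsilon>" if "0 < \<epsilon>" for \<epsilon>
      using cauchy[OF that] unfolding t(2) by (simp add: minus nrm t(1))
    then have "\<exists>x\<in>carrier V. (\<lambda>n. nrm V (t n \<ominus> x)) \<longlonglongrightarrow> 0"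
      using V.complete[unfolded V.mcomplete_iff] t(1) by blast
    then obtain x where "x \<in> carrier V" "(\<lambda>n. nrm V (t n \<ominus> x)) \<longlonglongrightarrow> 0"
      by blast
    then show "\<exists>x\<in>carrier W. (\<lambda>n. nrm W (s n \<ominus>\<^bsub>W\<^esub> x)) \<longlonglongrightarrow> 0"
      using t by (intro bexI[of _ "\<phi> x"]) (simp_all add: car minus nrm)
  qed
qed

text \<open>Needed because 0-injectivity tests only modules carried by the one type
  \<open>'u\<close>: both L1 and its unitization have to be moved there.\<close>

definition module_copy ::
  "('v \<Rightarrow> 'w) \<Rightarrow> ('a, 'v, 'n) left_module_scheme \<Rightarrow> ('a, 'w) left_module"
  where "module_copy \<phi> E = (let \<psi> = inv_into (carrier E) \<phi> in
    \<lparr>carrier = \<phi> ` carrier E,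
     mult = undefined,
     one = undefined,
     zero = \<phi> \<zero>\<^bsub>E\<^esub>,
     add = (\<lambda>x y. \<phi> (\<psi> x \<oplus>\<^bsub>E\<^esub> \<psi> y)),
     smult = (\<lambda>c x. \<phi> (c \<odot>\<^bsub>E\<^esub> \<psi> x)),
     nrm = (\<lambda>x. nrm E (\<psi> x)),
     act = (\<lambda>a x. \<phi> (act E a (\<psi> x)))\<rparr>)"

lemma module_copy_simps:
  "carrier (module_copy \<phi> E) = \<phi> ` carrier E"
  "\<zero>\<^bsub>module_copy \<phi> E\<^esub> = \<phi> \<zero>\<^bsub>E\<^esub>"
  "inj_on \<phi> (carrier E) \<Longrightarrow> x \<in> carrier E \<Longrightarrow> y \<in> carrier E
    \<Longrightarrow> \<phi> x \<oplus>\<^bsub>module_copy \<phi> E\<^esub> \<phi> y = \<phi> (x \<oplus>\<^bsub>E\<^esub> y)"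
  "inj_on \<phi> (carrier E) \<Longrightarrow> x \<in> carrier E
    \<Longrightarrow> c \<odot>\<^bsub>module_copy \<phi> E\<^esub> \<phi> x = \<phi> (c \<odot>\<^bsub>E\<^esub> x)"
  "inj_on \<phi> (carrier E) \<Longrightarrow> x \<in> carrier E \<Longrightarrow> nrm (module_copy \<phi> E) (\<phi> x) = nrm E x"
  "inj_on \<phi> (carrier E) \<Longrightarrow> x \<in> carrier E
    \<Longrightarrow> act (module_copy \<phi> E) a (\<phi> x) = \<phi> (act E a x)"
  by (simp_all add: module_copy_def Let_def)

lemma banach_left_module_copy:
  assumes "banach_left_module A E" and inj: "inj_on \<phi> (carrier E)"
  shows "banach_left_module A (module_copy \<phi> E)"
proof -
  interpret E: banach_left_module A E by fact
  note simps = module_copy_simps(1,2) module_copy_simps(3-)[OF inj]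
  interpret W: complex_banach_space "module_copy \<phi> E"
    by (rule complex_banach_space_copy[of E _ \<phi>])
      (use E.complex_banach_space_axioms inj in \<open>simp_all add: simps\<close>)
  have closed: "\<And>c x. x \<in> carrier E \<Longrightarrow> c \<odot>\<^bsub>E\<^esub> x \<in> carrier E"
    using E.smult_closed by simp
  show ?thesis
    using E.act_bounded
    by unfold_locales
      (auto simp: simps closed E.act_closed E.act_assoc E.act_distr_l E.act_distr_r
        E.act_smult_l E.act_smult_r)
qed

section \<open>The unitization and right identities\<close>

lemma regular_module_simps [simp]:
  "carrier (regular_module A) = carrier A"
  "zero (regular_module A) = zero A"
  "add (regular_module A) = add A"
  "smult (regular_module A) = smult A"
  "nrm (regular_module A) = nrm A"
  "act (regular_module A) = mult A"
  by (simp_all add: regular_module_def normed_module.extend_def left_module.fields_def)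

lemma banach_left_module_regular:
  assumes "complex_banach_algebra A"
  shows "banach_left_module A (regular_module A)"
proof -
  interpret A: complex_banach_algebra A by fact
  interpret E: complex_banach_space "regular_module A"
    by (rule complex_banach_space_copy[of A _ id]) (simp_all add: A.complex_banach_space_axioms)
  have "nrm A (a \<otimes>\<^bsub>A\<^esub> x) \<le> 1 * nrm A a * nrm A x" if "a \<in> carrier A" "x \<in> carrier A" for a x
    using A.nrm_mult that by simp
  then have "\<exists>C. \<forall>a\<in>carrier A. \<forall>x\<in>carrier A. nrm A (a \<otimes>\<^bsub>A\<^esub> x) \<le> C * nrm A a * nrm A x"
    by blast
  then show ?thesis
    by unfold_locales
      (simp_all add: A.mult_closed A.mult_assoc A.mult_distr_l A.mult_distr_r
        A.mult_smult_l A.mult_smult_r)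
qed

text \<open>A + C1 with the sum norm, kept only as a left A-module: a(x + z1) = ax + za. Products
  have scalar part 0, because A is an ideal in its unitization.\<close>

definition unitization :: "'a normed_module \<Rightarrow> ('a, 'a \<times> complex) left_module"
  where "unitization A =
    \<lparr>carrier = carrier A \<times> UNIV,
     mult = undefined,
     one = undefined,
     zero = (\<zero>\<^bsub>A\<^esub>, 0),
     add = (\<lambda>(x, z) (y, w). (x \<oplus>\<^bsub>A\<^esub> y, z + w)),
     smult = (\<lambda>c (x, z). (c \<odot>\<^bsub>A\<^esub> x, c * z)),
     nrm = (\<lambda>(x, z). nrm A x + cmod z),
     act = (\<lambda>a (x, z). (a \<otimes>\<^bsub>A\<^esub> x \<oplus>\<^bsub>A\<^esub> z \<odot>\<^bsub>A\<^esub> a, 0))\<rparr>"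

lemma unitization_simps [simp]:
  "carrier (unitization A) = carrier A \<times> UNIV"
  "\<zero>\<^bsub>unitization A\<^esub> = (\<zero>\<^bsub>A\<^esub>, 0)"
  "(x, z) \<oplus>\<^bsub>unitization A\<^esub> (y, w) = (x \<oplus>\<^bsub>A\<^esub> y, z + w)"
  "c \<odot>\<^bsub>unitization A\<^esub> (x, z) = (c \<odot>\<^bsub>A\<^esub> x, c * z)"
  "nrm (unitization A) (x, z) = nrm A x + cmod z"
  "act (unitization A) a (x, z) = (a \<otimes>\<^bsub>A\<^esub> x \<oplus>\<^bsub>A\<^esub> z \<odot>\<^bsub>A\<^esub> a, 0)"
  by (simp_all add: unitization_def)

lemma banach_left_module_unitization:
  fixes A :: "'a normed_module" (structure)
  assumes "complex_banach_algebra A"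
  shows "banach_left_module A (unitization A)"
proof -
  interpret A: complex_banach_algebra A by fact
  interpret A: complex_normed_space A by (rule A.complex_normed_space)
  let ?U = "unitization A"
  note smult = A.smult_closed[simplified] A.smult_one[simplified]
    A.smult_l_distr[simplified] A.smult_r_distr[simplified] A.smult_assoc1[simplified] A.smult_l_null[simplified]
  have inverse: "(- 1) \<odot> x \<oplus> x = \<zero>" if "x \<in> carrier A" for x
    using A.smult_l_minus[of 1 x] that by (simp add: smult A.l_neg)
  then have inverse': "x \<oplus> (- 1) \<odot> x = \<zero>" if "x \<in> carrier A" for x
    using that by (simp add: A.a_comm smult)
  have triangle: "cmod (z + w) + nrm A (x \<oplus> y) \<le> cmod z + (cmod w + (nrm A x + nrm A y))"
    if "x \<in> carrier A" "y \<in> carrier A" for x y z w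
    using A.nrm_triangle[OF that] norm_triangle_ineq[of z w] by linarith
  interpret U: complex_normed_space ?U
    by (rule complex_normed_spaceI)
      (auto simp: A.a_ac smult inverse inverse' A.nrm_nonneg A.nrm_smult algebra_simps
        add_nonneg_eq_0_iff A.nrm_eq_0_iff norm_mult triangle)
  have minus: "(x, z) \<ominus>\<^bsub>?U\<^esub> (y, w) = (x \<ominus> y, z - w)"
    if "x \<in> carrier A" "y \<in> carrier A" for x y z w
    using that by (simp add: U.minus_eq_add_smult A.minus_eq_add_smult)
  interpret U: complex_banach_space ?U
  proof (rule complex_banach_spaceI)
    show "complex_normed_space ?U" ..
  next
    fix s :: "nat \<Rightarrow> 'a \<times> complex" assume s: "\<And>n. s n \<in> carrier ?U"
      and cauchy: "\<And>\<epsilon>. 0 < \<epsilon> \<Longrightarrow> \<exists>N. \<forall>m\<ge>N. \<forall>n\<ge>N. nrm ?U (s m \<ominus>\<^bsub>?U\<^esub> s n) < \<epsilon>"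
    define x where "x n = fst (s n)" for n
    define z where "z n = snd (s n)" for n
    have s_eq: "s n = (x n, z n)" for n
      by (simp add: x_def z_def)
    have x: "x n \<in> carrier A" for n
      using s[of n] by (simp add: s_eq)
    have nrm: "nrm ?U (s m \<ominus>\<^bsub>?U\<^esub> s n) = nrm A (x m \<ominus> x n) + cmod (z m - z n)" for m n
      by (simp add: s_eq minus x)
    have "\<exists>N. \<forall>m\<ge>N. \<forall>n\<ge>N. nrm A (x m \<ominus> x n) < \<epsilon>" if "0 < \<epsilon>" for \<epsilon>
      using cauchy[OF that] unfolding nrm
      by (meson add_le_cancel_left le_add_same_cancel1 norm_ge_zero order.strict_trans1)
    then obtain x' where x': "x' \<in> carrier A" "(\<lambda>n. nrm A (x n \<ominus> x')) \<longlonglongrightarrow> 0"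
      using A.complete[unfolded A.mcomplete_iff] x by blast
    have "Cauchy z"
      unfolding Cauchy_def dist_norm
    proof (intro allI impI)
      fix \<epsilon> :: real assume "0 < \<epsilon>"
      then obtain N where "\<forall>m\<ge>N. \<forall>n\<ge>N. nrm A (x m \<ominus> x n) + cmod (z m - z n) < \<epsilon>"
        using cauchy unfolding nrm by blast
      moreover have "0 \<le> nrm A (x m \<ominus> x n)" for m n
        using A.nrm_nonneg x by simp
      ultimately show "\<exists>N. \<forall>m\<ge>N. \<forall>n\<ge>N. cmod (z m - z n) < \<epsilon>"
        by (meson add_increasing order_refl order.strict_trans1)
    qed
    then obtain z' where "z \<longlonglongrightarrow> z'"
      using Cauchy_convergent convergent_def by blast
    then have "(\<lambda>n. cmod (z n - z')) \<longlonglongrightarrow> 0"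
      by (simp add: LIM_zero tendsto_norm_zero)
    from tendsto_add[OF x'(2) this] have "(\<lambda>n. nrm ?U (s n \<ominus>\<^bsub>?U\<^esub> (x', z'))) \<longlonglongrightarrow> 0"
      by (simp add: s_eq minus x x')
    then show "\<exists>y\<in>carrier ?U. (\<lambda>n. nrm ?U (s n \<ominus>\<^bsub>?U\<^esub> y)) \<longlonglongrightarrow> 0"
      using x' by (intro bexI[of _ "(x', z')"]) auto
  qed
  have bound: "nrm ?U (act ?U a u) \<le> 1 * nrm A a * nrm ?U u"
    if a: "a \<in> carrier A" and "u \<in> carrier ?U" for a u
  proof -
    obtain x z where u: "u = (x, z)" "x \<in> carrier A"
      using \<open>u \<in> carrier ?U\<close> by (cases u) auto
    have "nrm A (a \<otimes> x \<oplus> z \<odot> a) \<le> nrm A (a \<otimes> x) + nrm A (z \<odot> a)"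
      using a u by (intro A.nrm_triangle) (auto simp: A.mult_closed smult)
    also have "\<dots> \<le> nrm A a * nrm A x + cmod z * nrm A a"
      using a u by (intro add_mono A.nrm_mult) (auto simp: A.nrm_smult)
    finally show ?thesis
      by (simp add: u algebra_simps)
  qed
  have smult_commute: "b \<odot> (z \<odot> a) = z \<odot> (b \<odot> a)" if "a \<in> carrier A" for a b z
    using that A.smult_assoc1[of b z a] A.smult_assoc1[of z b a] by (simp add: mult.commute)
  show ?thesis
  proof
    show "\<exists>C. \<forall>a\<in>carrier A. \<forall>x\<in>carrier ?U. nrm ?U (act ?U a x) \<le> C * nrm A a * nrm ?U x"
      using bound by blast
  qed (auto simp: A.mult_closed smult A.mult_assoc A.mult_distr_l A.mult_distr_r
      A.mult_smult_l A.mult_smult_r A.a_ac smult_commute)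
qed

text \<open>Extend the identity of A along the inclusion into the unitization to a morphism R. Then
  a = R(a1) = a R(1), so e = R(1) works.\<close>

lemma zero_injective_right_identity:
  fixes A :: "'a normed_module" (structure) and \<phi> :: "'a \<times> complex \<Rightarrow> 'u"
  assumes zi: "zero_injective TYPE('u) A (regular_module A)"
    and inj: "inj_on \<phi> (carrier A \<times> UNIV)"
  obtains e where "e \<in> carrier A" and "\<And>a. a \<in> carrier A \<Longrightarrow> a \<otimes> e = a"
proof -
  interpret A: complex_banach_algebra A
    using zi by (simp add: zero_injective_def banach_left_module_def)
  interpret A: complex_normed_space A by (rule A.complex_normed_space)
  \<comment> \<open>Using one injection for both copies makes the inclusion of A into its
    unitization the identity on a subset of \<open>'u\<close>.\<close>
  define \<iota> where "\<iota> a = \<phi> (a, 0)" for a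
  have inj': "inj_on \<iota> (carrier (regular_module A))"
    using inj by (auto simp: \<iota>_def inj_on_def)
  have injU: "inj_on \<phi> (carrier (unitization A))"
    using inj by simp
  define F where "F = module_copy \<iota> (regular_module A)"
  define K where "K = module_copy \<phi> (unitization A)"
  define T where "T = (\<lambda>u\<in>carrier F. u)"
  note smult = A.smult_closed[simplified] A.smult_l_null[simplified]
  note F = module_copy_simps(1,2)[of \<iota> "regular_module A", folded F_def]
    module_copy_simps(3-)[OF inj', folded F_def]
  note K = module_copy_simps(1,2)[of \<phi> "unitization A", folded K_def]
    module_copy_simps(3-)[OF injU, folded K_def]
  have modF: "banach_left_module A F" and modK: "banach_left_module A K"
    unfolding F_def K_def
    using banach_left_module_copy[OF _ inj'] banach_left_module_copy[OF _ injU]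
      banach_left_module_regular banach_left_module_unitization A.complex_banach_algebra_axioms
    by auto
  interpret K: banach_left_module A K by (rule modK)
  have T_\<iota> [simp]: "T (\<iota> a) = \<iota> a" if "a \<in> carrier A" for a
    using that by (simp add: T_def F)
  have \<iota>F: "\<iota> a \<in> carrier F" if "a \<in> carrier A" for a
    using that by (simp add: F)
  have carF: "carrier F = \<iota> ` carrier A"
    by (simp add: F)
  have bounded: "T \<in> bounded_ops F K"
  proof -
    have "T \<in> carrier F \<rightarrow>\<^sub>E carrier K"
      by (auto simp: T_def carF K \<iota>_def)
    moreover have "T (x \<oplus>\<^bsub>F\<^esub> y) = T x \<oplus>\<^bsub>K\<^esub> T y" if "x \<in> carrier F" "y \<in> carrier F" for x y
      using that by (auto simp: carF F T_def) (simp add: \<iota>_def K)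
    moreover have "T (c \<odot>\<^bsub>F\<^esub> x) = c \<odot>\<^bsub>K\<^esub> T x" if "x \<in> carrier F" for c x
      using that by (auto simp: carF F smult) (simp add: \<iota>_def K)
    moreover have "nrm K (T x) \<le> 1 * nrm F x" if "x \<in> carrier F" for x
      using that by (auto simp: carF F) (simp add: \<iota>_def K)
    ultimately show ?thesis
      unfolding bounded_ops_def by blast
  qed
  have T_module: "T \<in> module_ops A F K"
    using bounded unfolding module_ops_def
    by (auto simp: carF F A.mult_closed)
      (auto simp: \<iota>_def K A.mult_closed smult)
  have "admissible F K T"
  proof -
    \<comment> \<open>The projection x + z1 to x. Admissibility asks only for a bounded linear map,
      and in general this one is not a morphism.\<close>
    define S where "S = (\<lambda>u\<in>carrier K. \<iota> (fst (inv_into (carrier A \<times> UNIV) \<phi> u)))"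
    have S: "S (\<phi> (x, z)) = \<iota> x" if "x \<in> carrier A" for x z
      using that inj by (simp add: S_def K)
    have "S \<in> carrier K \<rightarrow>\<^sub>E carrier F"
      by (auto simp: S K \<iota>F) (auto simp: S_def K)
    moreover have "S (x \<oplus>\<^bsub>K\<^esub> y) = S x \<oplus>\<^bsub>F\<^esub> S y" if "x \<in> carrier K" "y \<in> carrier K" for x y
      using that by (auto simp: K S F)
    moreover have "S (c \<odot>\<^bsub>K\<^esub> x) = c \<odot>\<^bsub>F\<^esub> S x" if "x \<in> carrier K" for c x
      using that by (auto simp: K S F smult)
    moreover have "nrm F (S x) \<le> 1 * nrm K x" if "x \<in> carrier K" for x
      using that by (auto simp: K S F)
    ultimately have "S \<in> bounded_ops K F"
      unfolding bounded_ops_def by blast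
    moreover have "compose (carrier F) T (compose (carrier F) S T) = T"
    proof
      fix u show "compose (carrier F) T (compose (carrier F) S T) u = T u"
      proof (cases "u \<in> carrier F")
        case True
        then obtain a where "a \<in> carrier A" "u = \<iota> a"
          by (auto simp: carF)
        then show ?thesis
          using True S[of a 0] by (auto simp: compose_def T_def \<iota>_def)
      qed (simp add: compose_def T_def)
    qed
    ultimately show ?thesis
      using bounded unfolding admissible_def by blast
  qed
  moreover have "action_span A K \<subseteq> T ` carrier F"
    unfolding action_span_def vspan_def
  \<comment> \<open>The image of T consists of the elements with scalar part 0. It is a submodule
    and contains every product.\<close>
  proof (rule hull_minimal)
    show "{act K a k |a k. a \<in> carrier A \<and> k \<in> carrier K} \<subseteq> T ` carrier F"
      by (auto simp: K carF image_image A.mult_closed smult) (auto simp: \<iota>_def A.mult_closed smult)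
    have "T ` carrier F = (\<lambda>a. \<phi> (a, 0)) ` carrier A"
      by (auto simp: carF image_image) (auto simp: \<iota>_def)
    moreover have "\<ominus>\<^bsub>K\<^esub> (\<phi> (a, 0)) = \<phi> (\<ominus> a, 0)" if "a \<in> carrier A" for a
      using that by (intro K.minus_equality) (auto simp: K A.l_neg)
    ultimately show "submodule (T ` carrier F) complex_ring K"
      by (intro K.submoduleI) (auto simp: K smult intro!: imageI)
  qed
  moreover have "inj_on T (carrier F)"
    by (simp add: T_def inj_on_def)
  ultimately have onto: "(\<lambda>R. compose (carrier F) R T) ` module_ops A K (regular_module A)
      = module_ops A F (regular_module A)"
    using zi modF modK T_module unfolding zero_injective_def by blast
  \<comment> \<open>The identity of A, read off its copy in \<open>'u\<close>.\<close>
  define J where "J = (\<lambda>u\<in>carrier F. inv_into (carrier A) \<iota> u)"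
  have J: "J (\<iota> a) = a" if "a \<in> carrier A" for a
    using that inj' by (simp add: J_def \<iota>F)
  have "J \<in> module_ops A F (regular_module A)"
  proof -
    have "J \<in> carrier F \<rightarrow>\<^sub>E carrier A"
      by (auto simp: J carF) (auto simp: J_def carF)
    moreover have "nrm A (J x) \<le> 1 * nrm F x" if "x \<in> carrier F" for x
      using that by (auto simp: carF J F)
    moreover have "J (x \<oplus>\<^bsub>F\<^esub> y) = J x \<oplus> J y" if "x \<in> carrier F" "y \<in> carrier F" for x y
      using that by (auto simp: carF J F)
    moreover have "J (c \<odot>\<^bsub>F\<^esub> x) = c \<odot> J x" if "x \<in> carrier F" for c x
      using that by (auto simp: carF J F smult)
    moreover have "J (act F a x) = a \<otimes> J x" if "a \<in> carrier A" "x \<in> carrier F" for a x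
      using that by (auto simp: carF J F A.mult_closed)
    ultimately show ?thesis
      unfolding bounded_ops_def module_ops_def by (auto intro!: exI[of _ 1])
  qed
  with onto obtain R where R: "R \<in> module_ops A K (regular_module A)"
    and RJ: "compose (carrier F) R T = J"
    by (metis (no_types, lifting) imageE)
  \<comment> \<open>The adjoined unit, the only element of the unitization at which the extension R
    is evaluated explicitly.\<close>
  let ?one = "\<phi> (\<zero>, 1)"
  have one: "?one \<in> carrier K"
    by (simp add: K)
  have "a \<otimes> R ?one = a" if a: "a \<in> carrier A" for a
  proof -
    have "a \<otimes> \<zero> = \<zero>"
      using A.mult_smult_r[of a "\<zero>" 0] A.smult_l_null[of "\<zero>"] A.smult_l_null[of "a \<otimes> \<zero>"] a A.mult_closed[OF a]
      by simp
    then have act: "act K a ?one = \<iota> a"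
      using a by (simp add: K \<iota>_def A.smult_one[simplified])
    have "a \<otimes> R ?one = R (act K a ?one)"
      using R a one unfolding module_ops_def by auto
    also have "\<dots> = compose (carrier F) R T (\<iota> a)"
      using a by (simp add: act compose_def \<iota>F)
    also have "\<dots> = a"
      by (simp add: RJ J a)
    finally show ?thesis .
  qed
  moreover have "R ?one \<in> carrier A"
    using R one unfolding module_ops_def bounded_ops_def by auto
  ultimately show thesis
    using that by blast
qed

section \<open>The Banach space of integrable functions\<close>

lemma equiv_L1_rel: "equiv {f. integrable \<mu> f} (L1_rel \<mu>)"
proof (rule equivI)
  show "refl_on {f. integrable \<mu> f} (L1_rel \<mu>)"
    by (auto simp: refl_on_def L1_rel_def)
  show "sym (L1_rel \<mu>)"
    by (auto simp: sym_def L1_rel_def elim: eventually_mono)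
  show "trans (L1_rel \<mu>)"
    by (auto simp: trans_def L1_rel_def elim: eventually_elim2)
qed (auto simp: L1_rel_def)

lemma mem_L1_class_iff: "g \<in> L1_class \<mu> f \<longleftrightarrow> integrable \<mu> f \<and> integrable \<mu> g \<and> (AE x in \<mu>. f x = g x)"
  by (simp add: L1_rel_def)

lemma L1_class_eq_iff:
  assumes "integrable \<mu> f" "integrable \<mu> g"
  shows "L1_class \<mu> f = L1_class \<mu> g \<longleftrightarrow> (AE x in \<mu>. f x = g x)"
  using eq_equiv_class_iff[OF equiv_L1_rel, of f \<mu> g] assms by (simp add: L1_rel_def)

lemma carrier_L1: "carrier (L1 \<mu>) = L1_class \<mu> ` {f. integrable \<mu> f}"
  by (auto simp: L1_def quotient_def)

lemma L1_class_in_carrier [simp]: "integrable \<mu> f \<Longrightarrow> L1_class \<mu> f \<in> carrier (L1 \<mu>)"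
  by (simp add: carrier_L1)

lemma in_carrier_L1E:
  assumes "X \<in> carrier (L1 \<mu>)"
  obtains f where "integrable \<mu> f" "X = L1_class \<mu> f"
  using assms by (auto simp: carrier_L1)

lemma zero_L1: "\<zero>\<^bsub>L1 \<mu>\<^esub> = L1_class \<mu> (\<lambda>_. 0)"
  by (simp add: L1_def)

text \<open>The operations of \<open>L1\<close> are unions over all representatives; this collapses
  such a union once the choice of representative is known not to matter.\<close>

lemma UN_eqI:
  assumes "a \<in> X" "\<And>x. x \<in> X \<Longrightarrow> h x = Z"
  shows "(\<Union>x\<in>X. h x) = Z"
  using assms by auto

lemma L1_class_refl: "integrable \<mu> f \<Longrightarrow> f \<in> L1_class \<mu> f"
  by (simp add: L1_rel_def)

lemma add_L1:
  assumes "integrable \<mu> f" "integrable \<mu> g"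
  shows "L1_class \<mu> f \<oplus>\<^bsub>L1 \<mu>\<^esub> L1_class \<mu> g = L1_class \<mu> (\<lambda>x. f x + g x)"
proof -
  have *: "L1_class \<mu> (\<lambda>x. f' x + g' x) = L1_class \<mu> (\<lambda>x. f x + g x)"
    if "f' \<in> L1_class \<mu> f" "g' \<in> L1_class \<mu> g" for f' g'
    using that by (subst L1_class_eq_iff) (auto simp: L1_rel_def)
  have "(\<Union>f'\<in>L1_class \<mu> f. \<Union>g'\<in>L1_class \<mu> g. L1_class \<mu> (\<lambda>x. f' x + g' x))
      = L1_class \<mu> (\<lambda>x. f x + g x)"
    by (rule UN_eqI[OF L1_class_refl[OF assms(1)]], rule UN_eqI[OF L1_class_refl[OF assms(2)]],
        rule *)
  then show ?thesis
    by (simp add: L1_def del: Image_singleton_iff)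
qed

lemma smult_L1:
  assumes "integrable \<mu> f"
  shows "c \<odot>\<^bsub>L1 \<mu>\<^esub> L1_class \<mu> f = L1_class \<mu> (\<lambda>x. c * f x)"
proof -
  have *: "L1_class \<mu> (\<lambda>x. c * f' x) = L1_class \<mu> (\<lambda>x. c * f x)" if "f' \<in> L1_class \<mu> f" for f'
  proof -
    from that have "AE x in \<mu>. f x = f' x"
      by (simp add: L1_rel_def)
    then have "AE x in \<mu>. c * f' x = c * f x"
      by (rule eventually_mono) simp
    then show ?thesis
      using that by (subst L1_class_eq_iff) (simp_all add: L1_rel_def)
  qed
  have "(\<Union>f'\<in>L1_class \<mu> f. L1_class \<mu> (\<lambda>x. c * f' x)) = L1_class \<mu> (\<lambda>x. c * f x)"
    by (rule UN_eqI[OF L1_class_refl[OF assms]], rule *)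
  then show ?thesis
    by (simp add: L1_def del: Image_singleton_iff)
qed

lemma nrm_L1:
  assumes "integrable \<mu> f"
  shows "nrm (L1 \<mu>) (L1_class \<mu> f) = (\<integral>x. cmod (f x) \<partial>\<mu>)"
proof -
  have *: "(\<integral>x. cmod (f' x) \<partial>\<mu>) = (\<integral>x. cmod (f x) \<partial>\<mu>)" if "f' \<in> L1_class \<mu> f" for f'
    using that by (intro integral_cong_AE) (auto simp: L1_rel_def)
  have "(\<lambda>f. \<integral>x. cmod (f x) \<partial>\<mu>) ` L1_class \<mu> f = {\<integral>x. cmod (f x) \<partial>\<mu>}"
    using L1_class_refl[OF assms] * by (intro equalityI image_subsetI) (force simp del: Image_singleton_iff)+
  then show ?thesis
    by (simp add: L1_def)
qed

text \<open>Unlike for sums, independence of the representatives is not settled here, so the union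
  stays. It becomes a single class later: on discrete groups because classes are singletons, and for
  suitable factors because L1 is assumed to be closed under products.\<close>

lemma mult_L1:
  "X \<otimes>\<^bsub>L1 \<mu>\<^esub> Y = (\<Union>f\<in>X. \<Union>g\<in>Y. L1_class \<mu> (convolution \<mu> f g))"
  by (simp add: L1_def)

lemma complex_normed_space_L1: "complex_normed_space (L1 \<mu>)"
proof (rule complex_normed_spaceI)
  fix X c assume "X \<in> carrier (L1 \<mu>)"
  then obtain f where f: "integrable \<mu> f" "X = L1_class \<mu> f"
    by (rule in_carrier_L1E)
  show "nrm (L1 \<mu>) X = 0 \<longleftrightarrow> X = \<zero>\<^bsub>L1 \<mu>\<^esub>"
    using f integral_nonneg_eq_0_iff_AE[of \<mu> "\<lambda>x. cmod (f x)"]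
    by (simp add: nrm_L1 zero_L1 L1_class_eq_iff)
next
  fix X Y assume "X \<in> carrier (L1 \<mu>)" "Y \<in> carrier (L1 \<mu>)"
  then obtain f g where fg: "integrable \<mu> f" "X = L1_class \<mu> f" "integrable \<mu> g" "Y = L1_class \<mu> g"
    by (metis in_carrier_L1E)
  have "(\<integral>x. cmod (f x + g x) \<partial>\<mu>) \<le> (\<integral>x. cmod (f x) + cmod (g x) \<partial>\<mu>)"
    using fg by (intro integral_mono) (auto simp: norm_triangle_ineq)
  then show "nrm (L1 \<mu>) (X \<oplus>\<^bsub>L1 \<mu>\<^esub> Y) \<le> nrm (L1 \<mu>) X + nrm (L1 \<mu>) Y"
    using fg by (simp add: add_L1 nrm_L1)
qed (auto elim!: in_carrier_L1E simp: add_L1 smult_L1 zero_L1 nrm_L1 algebra_simps norm_mult)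

lemma minus_L1:
  assumes "integrable \<mu> f" "integrable \<mu> g"
  shows "L1_class \<mu> f \<ominus>\<^bsub>L1 \<mu>\<^esub> L1_class \<mu> g = L1_class \<mu> (\<lambda>x. f x - g x)"
  using assms
  by (simp add: complex_normed_space.minus_eq_add_smult[OF complex_normed_space_L1] smult_L1 add_L1)

text \<open>By monotone convergence the integral of the sum of norms equals the finite sum of the
  integrals, and a function with finite integral is finite almost everywhere.\<close>

lemma summable_norm_AE:
  fixes d :: "nat \<Rightarrow> 'a \<Rightarrow> 'b :: {banach, second_countable_topology}"
  assumes int: "\<And>k. integrable M (d k)"
    and sum: "summable (\<lambda>k. \<integral>x. norm (d k x) \<partial>M)"
  shows "AE x in M. summable (\<lambda>k. norm (d k x))"
proof -
  have [measurable]: "d k \<in> borel_measurable M" for k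
    using int by auto
  have "(\<integral>\<^sup>+x. (\<Sum>k. ennreal (norm (d k x))) \<partial>M) = (\<Sum>k. \<integral>\<^sup>+x. ennreal (norm (d k x)) \<partial>M)"
    by (rule nn_integral_suminf) simp
  also have "\<dots> = (\<Sum>k. ennreal (\<integral>x. norm (d k x) \<partial>M))"
    using int by (simp add: nn_integral_eq_integral)
  also have "\<dots> \<noteq> \<infinity>"
    using sum by (subst suminf_ennreal_eq) (auto intro: summable_sums)
  finally have "AE x in M. (\<Sum>k. ennreal (norm (d k x))) \<noteq> \<infinity>"
    by (intro nn_integral_PInf_AE) auto
  then show ?thesis
    by eventually_elim (auto intro: summable_suminf_not_top)
qed

text \<open>The Riesz-Fischer argument: a rapidly converging subsequence telescopes into an
  absolutely convergent series, and the Cauchy property carries its limit over to the whole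
  sequence.\<close>

lemma complex_banach_space_L1: "complex_banach_space (L1 \<mu>)"
proof (rule complex_banach_spaceI[OF complex_normed_space_L1])
  fix S :: "nat \<Rightarrow> ('a \<Rightarrow> complex) set"
  assume "\<And>n. S n \<in> carrier (L1 \<mu>)"
    and cauchy: "\<And>\<epsilon>. 0 < \<epsilon> \<Longrightarrow> \<exists>N. \<forall>m\<ge>N. \<forall>n\<ge>N. nrm (L1 \<mu>) (S m \<ominus>\<^bsub>L1 \<mu>\<^esub> S n) < \<epsilon>"
  then have "\<forall>n. \<exists>f. integrable \<mu> f \<and> S n = L1_class \<mu> f"
    by (metis in_carrier_L1E)
  then obtain s where s: "\<And>n. integrable \<mu> (s n)" "\<And>n. S n = L1_class \<mu> (s n)"
    by metis
  have nrm: "nrm (L1 \<mu>) (S m \<ominus>\<^bsub>L1 \<mu>\<^esub> S n) = (\<integral>x. cmod (s m x - s n x) \<partial>\<mu>)" for m n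
    by (simp add: s minus_L1 nrm_L1)
  have "\<exists>N. \<forall>m\<ge>N. \<forall>n\<ge>N. (\<integral>x. cmod (s m x - s n x) \<partial>\<mu>) < (1/2) ^ k" for k
    using cauchy[of "(1/2) ^ k"] unfolding nrm by simp
  then obtain N where N: "\<And>k m n. N k \<le> m \<Longrightarrow> N k \<le> n \<Longrightarrow> (\<integral>x. cmod (s m x - s n x) \<partial>\<mu>) < (1/2) ^ k"
    by metis
  \<comment> \<open>Partial sums of \<open>N\<close> dominate each \<open>N k\<close> and are
    monotone, which \<open>N\<close> itself need not be.\<close>
  define r where "r k = (\<Sum>i\<le>k. N i)" for k
  have r: "N k \<le> r k" "r k \<le> r (Suc k)" for k
    by (auto simp: r_def intro: member_le_sum)
  define d where "d k x = s (r (Suc k)) x - s (r k) x" for k x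
  have d_int: "integrable \<mu> (d k)" for k
    unfolding d_def using s(1) by auto
  have d_le: "(\<integral>x. cmod (d k x) \<partial>\<mu>) \<le> (1/2) ^ k" for k
    unfolding d_def using r[of k] by (intro less_imp_le[OF N]) auto
  have d_sum: "summable (\<lambda>k. \<integral>x. cmod (d k x) \<partial>\<mu>)"
    by (rule summable_comparison_test[OF _ summable_geometric[of "1/2"]])
      (auto intro!: exI[of _ 0] d_le integral_nonneg_AE)
  have AE: "AE x in \<mu>. summable (\<lambda>k. norm (d k x))"
    by (rule summable_norm_AE[OF d_int d_sum])
  \<comment> \<open>Almost everywhere the limit of the subsequence, written as its first term plus
    all increments.\<close>
  define f where "f x = s (r 0) x + (\<Sum>k. d k x)" for x
  have f: "integrable \<mu> f"
    unfolding f_def using integrable_suminf[OF d_int AE d_sum] s(1) by auto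
  have tail: "(\<integral>x. cmod (s (r n) x - f x) \<partial>\<mu>) \<le> (\<Sum>k. \<integral>x. cmod (d (k + n) x) \<partial>\<mu>)" for n
  proof -
    have sum_n: "summable (\<lambda>k. \<integral>x. cmod (d (k + n) x) \<partial>\<mu>)"
      using d_sum by (rule summable_ignore_initial_segment)
    have AE_n: "AE x in \<mu>. summable (\<lambda>k. norm (d (k + n) x))"
      using AE by eventually_elim (rule summable_ignore_initial_segment)
    have "(\<integral>x. cmod (s (r n) x - f x) \<partial>\<mu>) \<le> (\<integral>x. (\<Sum>k. cmod (d (k + n) x)) \<partial>\<mu>)"
    proof (rule integral_mono_AE)
      show "integrable \<mu> (\<lambda>x. cmod (s (r n) x - f x))"
        using s(1) f by auto
      show "integrable \<mu> (\<lambda>x. \<Sum>k. cmod (d (k + n) x))"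
        using AE_n sum_n by (intro integrable_suminf) (auto intro: d_int)
      show "AE x in \<mu>. cmod (s (r n) x - f x) \<le> (\<Sum>k. cmod (d (k + n) x))"
        using AE AE_n
      proof eventually_elim
        case (elim x)
        have "s (r n) x = s (r 0) x + (\<Sum>k<n. d k x)"
          unfolding d_def by (subst sum_lessThan_telescope) simp
        then have "f x - s (r n) x = (\<Sum>k. d (k + n) x)"
          using suminf_split_initial_segment[OF summable_norm_cancel[OF elim(1)], of n]
          by (simp add: f_def)
        then show ?case
          using summable_norm[OF elim(2)] by (metis norm_minus_commute)
      qed
    qed
    also have "\<dots> = (\<Sum>k. \<integral>x. cmod (d (k + n) x) \<partial>\<mu>)"
      using AE_n sum_n by (intro integral_suminf) (auto intro: d_int)
    finally show ?thesis .
  qed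
  have sub: "(\<lambda>n. \<integral>x. cmod (s (r n) x - f x) \<partial>\<mu>) \<longlonglongrightarrow> 0"
    by (rule tendsto_sandwich[OF _ _ tendsto_const suminf_exist_split2[OF d_sum]])
      (use tail in \<open>auto intro: always_eventually\<close>)
  have "(\<lambda>n. \<integral>x. cmod (s n x - f x) \<partial>\<mu>) \<longlonglongrightarrow> 0"
  proof (rule LIMSEQ_I)
    fix \<epsilon> :: real assume "0 < \<epsilon>"
    then obtain n\<^sub>0 where n0: "\<And>n. n\<^sub>0 \<le> n \<Longrightarrow> (\<integral>x. cmod (s (r n) x - f x) \<partial>\<mu>) < \<epsilon> / 2"
      using LIMSEQ_D[OF sub, of "\<epsilon> / 2"] by fastforce
    obtain k\<^sub>0 where k0: "(1/2) ^ k\<^sub>0 < \<epsilon> / 2"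
      using real_arch_pow_inv[of "\<epsilon>/2" "1/2"] \<open>0 < \<epsilon>\<close> by auto
    define k where "k = max n\<^sub>0 k\<^sub>0"
    have "(1/2::real) ^ k \<le> (1/2) ^ k\<^sub>0"
      by (rule power_decreasing) (auto simp: k_def)
    have "(\<integral>x. cmod (s n x - f x) \<partial>\<mu>) < \<epsilon>" if "N k \<le> n" for n
    proof -
      have "(\<integral>x. cmod (s n x - f x) \<partial>\<mu>)
          \<le> (\<integral>x. cmod (s n x - s (r k) x) + cmod (s (r k) x - f x) \<partial>\<mu>)"
        using s(1) f by (intro integral_mono)
          (auto intro: order_trans[OF _ norm_triangle_ineq[of "s n _ - s (r k) _" "s (r k) _ - f _"]])
      also have "\<dots> = (\<integral>x. cmod (s n x - s (r k) x) \<partial>\<mu>) + (\<integral>x. cmod (s (r k) x - f x) \<partial>\<mu>)"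
        using s(1) f by (intro Bochner_Integration.integral_add) auto
      also have "\<dots> < (1/2) ^ k + \<epsilon> / 2"
        using that r by (intro add_strict_mono N n0) (auto simp: k_def)
      finally show ?thesis
        using k0 \<open>(1/2::real) ^ k \<le> (1/2) ^ k\<^sub>0\<close> by linarith
    qed
    then show "\<exists>M. \<forall>n\<ge>M. norm ((\<integral>x. cmod (s n x - f x) \<partial>\<mu>) - 0) < \<epsilon>"
      by (auto intro!: exI[of _ "N k"])
  qed
  then show "\<exists>X\<in>carrier (L1 \<mu>). (\<lambda>n. nrm (L1 \<mu>) (S n \<ominus>\<^bsub>L1 \<mu>\<^esub> X)) \<longlonglongrightarrow> 0"
    using f by (intro bexI[of _ "L1_class \<mu> f"]) (simp_all add: s minus_L1 nrm_L1)
qed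

section \<open>Haar measure\<close>

locale haar =
  fixes \<mu> :: "'g :: {topological_group_add, t2_space} measure"
  assumes haar: "left_haar_measure \<mu>"
begin

lemmas haar_conds = haar[unfolded left_haar_measure_def]

lemma sets_haar [simp, measurable_cong]: "sets \<mu> = sets borel"
  using haar by (simp add: left_haar_measure_def)

lemma space_haar [simp]: "space \<mu> = UNIV"
  using sets_eq_imp_space_eq[OF sets_haar] by simp

lemma compact_finite: "compact K \<Longrightarrow> emeasure \<mu> K < \<infinity>"
  by (rule haar_conds[THEN conjunct2, THEN conjunct1, rule_format])

lemma outer_regular:
  "A \<in> sets borel \<Longrightarrow> emeasure \<mu> A = (INF U\<in>{U. open U \<and> A \<subseteq> U}. emeasure \<mu> U)"
  by (rule haar_conds[THEN conjunct2, THEN conjunct2, THEN conjunct1, THEN bspec])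

lemma inner_regular:
  "open U \<Longrightarrow> emeasure \<mu> U = (SUP K\<in>{K. compact K \<and> K \<subseteq> U}. emeasure \<mu> K)"
  by (rule haar_conds[THEN conjunct2, THEN conjunct2, THEN conjunct2, THEN conjunct1, rule_format])

lemma emeasure_UNIV_nonzero: "emeasure \<mu> UNIV \<noteq> 0"
  by (rule haar_conds[THEN conjunct2, THEN conjunct2, THEN conjunct2, THEN conjunct2, THEN conjunct1])

lemma emeasure_translate: "A \<in> sets borel \<Longrightarrow> emeasure \<mu> ((+) a ` A) = emeasure \<mu> A"
  using haar_conds[THEN conjunct2, THEN conjunct2, THEN conjunct2, THEN conjunct2, THEN conjunct2] by blast

lemma open_translate:
  fixes a :: 'g
  assumes "open U"
  shows "open ((+) a ` U)"
proof -
  have "(+) a ` U = (\<lambda>x. - a + x) -` U"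
    by (force simp: image_iff add.assoc[symmetric])
  then show ?thesis
    using assms by (auto intro!: open_vimage continuous_intros)
qed

text \<open>Inner regularity of the whole group turns nontriviality of \<mu> into the existence of a
  compact witness.\<close>

lemma exists_compact_nonnull: "\<exists>K. compact K \<and> emeasure \<mu> K \<noteq> 0"
proof (rule ccontr)
  assume "\<not> ?thesis"
  then have "emeasure \<mu> UNIV \<le> 0"
    unfolding inner_regular[OF open_UNIV] by (intro SUP_least) auto
  with emeasure_UNIV_nonzero show False
    by simp
qed

text \<open>Finitely many translates of a nonempty open set cover a compact set of positive measure;
  if the open set were null, so would be its translates and the compact set.\<close>

lemma emeasure_open_pos:
  assumes "open U" "U \<noteq> {}"
  shows "emeasure \<mu> U \<noteq> 0"
proof
  assume null: "emeasure \<mu> U = 0"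
  obtain K where K: "compact K" "emeasure \<mu> K \<noteq> 0"
    using exists_compact_nonnull by blast
  obtain u where u: "u \<in> U"
    using assms by auto
  have cover: "K \<subseteq> (\<Union>a\<in>UNIV. (+) a ` U)"
  proof
    fix k assume "k \<in> K"
    have "k = (k - u) + u"
      by simp
    then show "k \<in> (\<Union>a\<in>UNIV. (+) a ` U)"
      using u by blast
  qed
  obtain C where C: "finite C" "K \<subseteq> (\<Union>a\<in>C. (+) a ` U)"
    by (rule compactE_image[OF K(1) open_translate[OF assms(1)] cover])
  have "emeasure \<mu> K \<le> emeasure \<mu> (\<Union>a\<in>C. (+) a ` U)"
    using C open_translate[OF assms(1)] by (intro emeasure_mono) auto
  also have "\<dots> \<le> (\<Sum>a\<in>C. emeasure \<mu> ((+) a ` U))"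
    using C open_translate[OF assms(1)] by (intro emeasure_subadditive_finite) auto
  also have "\<dots> = 0"
    using assms null by (simp add: emeasure_translate)
  finally show False
    using K by simp
qed

lemma measurable_translate [measurable]: "(\<lambda>y. - y + x) \<in> borel \<rightarrow>\<^sub>M (borel :: 'g measure)"
  by (intro borel_measurable_continuous_onI continuous_intros)

text \<open>Lower semicontinuity takes the place of Tonelli's theorem, which does not apply
  since the product of the Borel \<open>\<sigma>\<close>-algebras can be smaller than the Borel \<open>\<sigma>\<close>-algebra of
  the product.\<close>

lemma borel_measurable_overlap_open:
  assumes U: "open U" and N: "open N"
  shows "(\<lambda>x. emeasure \<mu> {y \<in> U. - y + x \<in> N}) \<in> borel_measurable borel"
proof (rule borel_measurableI_greater)
  fix t
  let ?O = "\<lambda>x. {y \<in> U. - y + x \<in> N}"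
  have "?O x = U \<inter> (\<lambda>y. - y + x) -` N" for x
    by auto
  then have O: "open (?O x)" for x
    using U N by (auto intro!: open_Int open_vimage continuous_intros)
  have W: "open {(x, y). - y + x \<in> N}"
  proof -
    have "{(x, y). - y + x \<in> N} = (\<lambda>p. - snd p + fst p) -` N"
      by auto
    then show ?thesis
      using N by (auto intro!: open_vimage continuous_intros)
  qed
  have "open {x. t < emeasure \<mu> (?O x)}"
  proof (subst open_subopen, intro ballI)
    fix x assume "x \<in> {x. t < emeasure \<mu> (?O x)}"
    then have "t < emeasure \<mu> (?O x)"
      by simp
    then obtain K where K: "compact K" "K \<subseteq> ?O x" "t < emeasure \<mu> K"
      unfolding inner_regular[OF O] less_SUP_iff by auto
    \<comment> \<open>The condition is open in the pair (x, y), so by the tube lemma the compact K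
      remains inside the overlap for all points near x.\<close>
    have "{x} \<times> K \<subseteq> {(x, y). - y + x \<in> N}"
      using K by auto
    from Elementary_Topology.tube_lemma[OF K(1) W this] obtain X where
      X: "x \<in> X" "open X" "X \<times> K \<subseteq> {(x, y). - y + x \<in> N}"
      by blast
    have "t < emeasure \<mu> (?O x')" if "x' \<in> X" for x'
    proof -
      have "K \<subseteq> ?O x'"
        using that X K by auto
      then have "emeasure \<mu> K \<le> emeasure \<mu> (?O x')"
        using O by (intro emeasure_mono) auto
      with K show ?thesis
        by simp
    qed
    with X show "\<exists>T. open T \<and> x \<in> T \<and> T \<subseteq> {x. t < emeasure \<mu> (?O x)}"
      by blast
  qed
  then show "{x \<in> space borel. t < emeasure \<mu> (?O x)} \<in> sets borel"
    by simp
qed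

text \<open>The complement of \<open>C\<close> is open, so the open case applies to it; finiteness
  of \<mu>(U) permits the subtraction.\<close>

lemma borel_measurable_overlap_compact:
  assumes U: "open U" "emeasure \<mu> U < \<infinity>" and C: "compact C"
  shows "(\<lambda>x. measure \<mu> {y \<in> U. - y + x \<in> C}) \<in> borel_measurable borel"
proof -
  have C': "open (- C)"
    using C compact_imp_closed by auto
  have eq: "measure \<mu> {y \<in> U. - y + x \<in> C} = measure \<mu> U - enn2real (emeasure \<mu> {y \<in> U. - y + x \<in> - C})" for x
  proof -
    have [measurable]: "U \<in> sets borel" "- C \<in> sets borel"
      using U C' by auto
    have "{y \<in> U. - y + x \<in> - C} = U \<inter> (\<lambda>y. - y + x) -` (- C)"
      by auto
    then have "{y \<in> U. - y + x \<in> - C} \<in> sets \<mu>"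
      using U C' by (auto intro!: open_Int open_vimage continuous_intros borel_open)
    then have "measure \<mu> (U - {y \<in> U. - y + x \<in> - C}) = measure \<mu> U - measure \<mu> {y \<in> U. - y + x \<in> - C}"
      using U by (intro measure_Diff) auto
    moreover have "U - {y \<in> U. - y + x \<in> - C} = {y \<in> U. - y + x \<in> C}"
      by auto
    ultimately show ?thesis
      by (simp add: measure_def)
  qed
  have [measurable]: "(\<lambda>x. emeasure \<mu> {y \<in> U. - y + x \<in> - C}) \<in> borel_measurable borel"
    using borel_measurable_overlap_open[OF U(1) C'] .
  show ?thesis
    unfolding eq by measurable
qed

section \<open>Approximation by functions with integrable convolutions\<close>

text \<open>What the approximant g of the right identity must satisfy. All open subsets of
  \<open>V\<close> are treated at once because g is chosen before the set U to which it is
  applied.\<close>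

definition tame :: "'g set \<Rightarrow> ('g \<Rightarrow> complex) \<Rightarrow> bool"
  where "tame V g \<longleftrightarrow> integrable \<mu> g \<and> (\<exists>M. \<forall>x. cmod (g x) \<le> M) \<and>
    (\<forall>U. open U \<longrightarrow> U \<subseteq> V \<longrightarrow> integrable \<mu> (convolution \<mu> (indicator U) g))"

lemma integrable_indicator_open:
  assumes "compact V" "open U" "U \<subseteq> V"
  shows "integrable \<mu> (indicator U :: 'g \<Rightarrow> complex)"
proof (rule integrableI_bounded_set[of U _ _ 1])
  show "emeasure \<mu> U < \<infinity>"
    using compact_finite[OF assms(1)] emeasure_mono[of U V \<mu>] assms
    by (auto intro: le_less_trans dest: compact_imp_closed)
  have "U \<in> sets borel"
    using assms by simp
  then show "(indicator U :: 'g \<Rightarrow> complex) \<in> borel_measurable \<mu>" "U \<in> sets \<mu>"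
    by auto
qed (auto simp: indicator_def)

lemma integrable_convolution_integrand:
  assumes "compact V" "open U" "U \<subseteq> V" "g \<in> borel_measurable borel" "\<And>x. cmod (g x) \<le> M"
  shows "integrable \<mu> (\<lambda>y. indicator U y * g (- y + x))"
proof (rule Bochner_Integration.integrable_bound)
  show "integrable \<mu> (\<lambda>y. complex_of_real M * indicator U y)"
    using integrable_indicator_open[OF assms(1-3)] by simp
  have [measurable]: "g \<in> borel_measurable borel" "U \<in> sets borel"
    using assms by auto
  show "(\<lambda>y. indicator U y * g (- y + x)) \<in> borel_measurable \<mu>"
    by measurable
  show "AE y in \<mu>. norm (indicator U y * g (- y + x)) \<le> norm (complex_of_real M * indicator U y)"
    using assms(5) by (auto simp: indicator_def intro!: AE_I2 order_trans[OF _ abs_ge_self])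
qed

text \<open>Boundedness makes the integrand of the convolution integrable at every point, so
  convolution with 1_U is additive everywhere and not just almost everywhere.\<close>

lemma tame_add:
  assumes V: "compact V" and f: "tame V f" and g: "tame V g"
  shows "tame V (\<lambda>x. f x + g x)"
proof -
  obtain M where M: "\<And>x. cmod (f x) \<le> M"
    using f by (auto simp: tame_def)
  obtain N where N: "\<And>x. cmod (g x) \<le> N"
    using g by (auto simp: tame_def)
  have meas: "f \<in> borel_measurable borel" "g \<in> borel_measurable borel"
    using f g by (auto simp: tame_def dest: borel_measurable_integrable)
  have "convolution \<mu> (indicator U) (\<lambda>x. f x + g x)
      = (\<lambda>x. convolution \<mu> (indicator U) f x + convolution \<mu> (indicator U) g x)"
    if "open U" "U \<subseteq> V" for U
    using integrable_convolution_integrand[OF V that meas(1) M]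
      integrable_convolution_integrand[OF V that meas(2) N]
    by (simp add: convolution_def fun_eq_iff distrib_left)
  moreover have "\<forall>x. cmod (f x + g x) \<le> M + N"
    using M N by (auto intro: norm_triangle_mono)
  ultimately show ?thesis
    using f g by (auto simp: tame_def)
qed

text \<open>The convolution of 1_U and 1_C at x is the measure of the overlap of U with x - C. This
  is measurable in x, bounded by \<mu>(U), and zero off a compact set.\<close>

lemma tame_indicator_compact:
  assumes V: "compact V" and C: "compact C"
  shows "tame V (\<lambda>x. indicator C x *\<^sub>R c)"
  unfolding tame_def
proof (intro conjI allI impI)
  have [measurable]: "C \<in> sets borel"
    using C by (simp add: compact_imp_closed)
  show "integrable \<mu> (\<lambda>x. indicator C x *\<^sub>R c)"
    using compact_finite[OF C] by (intro integrableI_bounded_set_indicator[of _ _ _ "cmod c"]) auto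
  show "\<exists>M. \<forall>x. cmod (indicator C x *\<^sub>R c) \<le> M"
    by (intro exI[of _ "cmod c"]) (auto simp: indicator_def)
  fix U assume U: "open U" "U \<subseteq> V"
  have fin: "emeasure \<mu> U < \<infinity>"
    using compact_finite[OF V] emeasure_mono[of U V \<mu>] U V
    by (auto intro: le_less_trans dest: compact_imp_closed)
  have sets: "{y \<in> U. - y + x \<in> C} \<in> sets \<mu>" for x
  proof -
    have [measurable]: "U \<in> sets borel"
      using U by simp
    show ?thesis by measurable
  qed
  have le: "emeasure \<mu> {y \<in> U. - y + x \<in> C} \<le> emeasure \<mu> U" for x
    using U by (intro emeasure_mono) auto
  have conv: "convolution \<mu> (indicator U) (\<lambda>x. indicator C x *\<^sub>R c) x
      = measure \<mu> {y \<in> U. - y + x \<in> C} *\<^sub>R c" for x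
  proof -
    have "convolution \<mu> (indicator U) (\<lambda>x. indicator C x *\<^sub>R c) x
        = (\<integral>y. indicator {y \<in> U. - y + x \<in> C} y *\<^sub>R c \<partial>\<mu>)"
      unfolding convolution_def by (intro Bochner_Integration.integral_cong) (auto simp: indicator_def)
    also have "\<dots> = measure \<mu> {y \<in> U. - y + x \<in> C} *\<^sub>R c"
      using sets le_less_trans[OF le fin] by simp
    finally show ?thesis .
  qed
  \<comment> \<open>The set V + C, compact as a continuous image. Any y in U with -y + x in C
    exhibits x as an element of it.\<close>
  let ?P = "(\<lambda>p. fst p + snd p) ` (V \<times> C)"
  have P: "compact ?P"
    using V C by (intro compact_continuous_image compact_Times continuous_intros)
  have "integrable \<mu> (\<lambda>x. measure \<mu> {y \<in> U. - y + x \<in> C} *\<^sub>R c)"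
  proof (rule integrableI_bounded_set[of ?P _ _ "measure \<mu> U * cmod c"])
    show "?P \<in> sets \<mu>"
      using P by (simp add: compact_imp_closed)
    show "(\<lambda>x. measure \<mu> {y \<in> U. - y + x \<in> C} *\<^sub>R c) \<in> borel_measurable \<mu>"
      using borel_measurable_overlap_compact[OF U(1) fin C] by measurable
    show "emeasure \<mu> ?P < \<infinity>"
      by (rule compact_finite[OF P])
    have "measure \<mu> {y \<in> U. - y + x \<in> C} \<le> measure \<mu> U" for x
      unfolding measure_def using le fin by (intro enn2real_mono) auto
    then show "AE x in \<mu>. x \<in> ?P \<longrightarrow> cmod (measure \<mu> {y \<in> U. - y + x \<in> C} *\<^sub>R c) \<le> measure \<mu> U * cmod c"
      by (auto intro!: AE_I2 mult_right_mono)
    have "measure \<mu> {y \<in> U. - y + x \<in> C} = 0" if "x \<notin> ?P" for x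
    proof -
      have "x \<in> ?P" if "y \<in> U" "- y + x \<in> C" for y
        using that U by (intro image_eqI[of _ _ "(y, - y + x)"]) (auto simp: add.assoc[symmetric])
      with that have "{y \<in> U. - y + x \<in> C} = {}"
        by blast
      then show ?thesis
        by (simp only: measure_empty)
    qed
    then show "AE x in \<mu>. x \<notin> ?P \<longrightarrow> measure \<mu> {y \<in> U. - y + x \<in> C} *\<^sub>R c = 0"
      by (intro AE_I2) auto
  qed
  then show "integrable \<mu> (convolution \<mu> (indicator U) (\<lambda>x. indicator C x *\<^sub>R c))"
    unfolding conv[abs_def] .
qed

text \<open>Inner regularity is available for open sets only, so \<open>C\<close> is not sought
  inside \<open>A\<close>. Both sit in an open O' of nearly the same measure as each, and |1_A -
  1_C| is at most (1_O' - 1_A) + (1_O' - 1_C).\<close>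

lemma compact_approx:
  assumes A: "A \<in> sets borel" "emeasure \<mu> A < \<infinity>" and "0 < \<delta>"
  obtains C where "compact C"
    "(\<integral>x. \<bar>indicator A x - indicator C x\<bar> \<partial>\<mu>) \<le> (\<delta> :: real)"
proof -
  have "emeasure \<mu> A < emeasure \<mu> A + ennreal (\<delta> / 2)"
    using A \<open>0 < \<delta>\<close> by (simp add: ennreal_add_left_cancel_less less_top)
  then obtain O' where O: "open O'" "A \<subseteq> O'" "emeasure \<mu> O' < emeasure \<mu> A + ennreal (\<delta> / 2)"
    unfolding outer_regular[OF A(1)] INF_less_iff by (auto simp flip: outer_regular[OF A(1)])
  have fin: "emeasure \<mu> O' < \<infinity>"
    using O(3) A by (auto intro: less_trans simp: less_top)
  obtain C where C: "compact C" "C \<subseteq> O'" "emeasure \<mu> O' \<le> emeasure \<mu> C + ennreal (\<delta> / 2)"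
  \<comment> \<open>Subtracting \<delta>/2 lowers the measure strictly only if it is nonzero; a null
    O' is approximated by the empty set.\<close>
  proof (cases "emeasure \<mu> O' = 0")
    case True
    then show ?thesis using that[of "{}"] by simp
  next
    case False
    then have "emeasure \<mu> O' - ennreal (\<delta> / 2) < emeasure \<mu> O'"
      using fin \<open>0 < \<delta>\<close> by (intro ennreal_between) (auto simp: less_top zero_less_iff_neq_zero)
    then obtain C where C: "compact C" "C \<subseteq> O'" "emeasure \<mu> O' - ennreal (\<delta> / 2) < emeasure \<mu> C"
      by (subst (asm) (2) inner_regular[OF O(1)]) (auto simp: less_SUP_iff)
    from C(3) have "emeasure \<mu> O' \<le> emeasure \<mu> C + ennreal (\<delta> / 2)"
      using ennreal_minus_le_iff[of "emeasure \<mu> O'" "ennreal (\<delta> / 2)"] less_imp_le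
      by (metis add.commute)
    with C(1,2) show ?thesis
      by (rule that)
  qed
  have [measurable]: "C \<in> sets borel" "O' \<in> sets borel" "A \<in> sets borel"
    using C O A by (auto simp: compact_imp_closed)
  have fmC: "emeasure \<mu> C < \<infinity>"
    by (rule compact_finite[OF C(1)])
  have int: "integrable \<mu> (indicator B :: 'g \<Rightarrow> real)" if "B \<in> sets borel" "emeasure \<mu> B < \<infinity>" for B
    using that by simp
  have "measure \<mu> O' \<le> measure \<mu> A + \<delta> / 2"
  proof -
    have "ennreal (measure \<mu> O') \<le> ennreal (measure \<mu> A + \<delta> / 2)"
      using O(3) A fin \<open>0 < \<delta>\<close> by (simp add: emeasure_eq_ennreal_measure less_top ennreal_plus)
    then show ?thesis
      by (subst (asm) ennreal_le_iff) (use \<open>0 < \<delta>\<close> in auto)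
  qed
  moreover have "measure \<mu> O' \<le> measure \<mu> C + \<delta> / 2"
  proof -
    have "ennreal (measure \<mu> O') \<le> ennreal (measure \<mu> C + \<delta> / 2)"
      using C(3) fmC fin \<open>0 < \<delta>\<close> by (simp add: emeasure_eq_ennreal_measure less_top ennreal_plus)
    then show ?thesis
      by (subst (asm) ennreal_le_iff) (use \<open>0 < \<delta>\<close> in auto)
  qed
  moreover have "(\<integral>x. \<bar>indicator A x - indicator C x\<bar> \<partial>\<mu>)
      \<le> (\<integral>x. (indicator O' x - indicator A x) + (indicator O' x - indicator C x) \<partial>\<mu> :: real)"
    using O(2) C(2) A fin fmC
    by (intro integral_mono integrable_abs Bochner_Integration.integrable_add
        Bochner_Integration.integrable_diff int) (auto simp: indicator_def)
  moreover have "(\<integral>x. (indicator O' x - indicator A x) + (indicator O' x - indicator C x) \<partial>\<mu> :: real)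
      = (measure \<mu> O' - measure \<mu> A) + (measure \<mu> O' - measure \<mu> C)"
    using int fin fmC A by simp
  ultimately show thesis
    using that[OF C(1)] by simp
qed

text \<open>Tame functions are not shown to be closed under limits. Density is the property that
  survives the limit step: approximate f by some term of the sequence, and that term by a tame
  function, each up to \<epsilon>/2.\<close>

lemma tame_dense:
  fixes f :: "'g \<Rightarrow> complex"
  assumes V: "compact V" and "integrable \<mu> f" and "0 < \<epsilon>"
  shows "\<exists>g. tame V g \<and> (\<integral>x. cmod (f x - g x) \<partial>\<mu>) < \<epsilon>"
  using assms(2,3)
proof (induction arbitrary: \<epsilon> rule: integrable_induct)
  case (base A c)
  then have A: "A \<in> sets borel" "emeasure \<mu> A < \<infinity>"
    by auto
  \<comment> \<open>The summand 1 keeps the quotient meaningful for c = 0.\<close>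
  have "0 < \<epsilon> / (cmod c + 1)"
    using base by (simp add: add_nonneg_pos)
  from compact_approx[OF A this] obtain C where C: "compact C"
    "(\<integral>x. \<bar>indicator A x - indicator C x\<bar> \<partial>\<mu>) \<le> \<epsilon> / (cmod c + 1)"
    by blast
  have "(\<integral>x. cmod (indicator A x *\<^sub>R c - indicator C x *\<^sub>R c) \<partial>\<mu>)
      = (\<integral>x. \<bar>indicator A x - indicator C x\<bar> * cmod c \<partial>\<mu>)"
    by (simp flip: scaleR_left_diff_distrib)
  also have "\<dots> = (\<integral>x. \<bar>indicator A x - indicator C x\<bar> \<partial>\<mu>) * cmod c"
    by simp
  also have "\<dots> \<le> \<epsilon> / (cmod c + 1) * cmod c"
    using C by (intro mult_right_mono) auto
  also have "\<dots> < \<epsilon>"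
  proof -
    have "0 < cmod c + 1"
      by (simp add: add_nonneg_pos)
    then have "cmod c / (cmod c + 1) < 1"
      by simp
    from mult_strict_left_mono[OF this \<open>0 < \<epsilon>\<close>] show ?thesis
      by simp
  qed
  finally show ?case
    using tame_indicator_compact[OF V C(1)] by blast
next
  case (add f g)
  obtain f' where f': "tame V f'" "(\<integral>x. cmod (f x - f' x) \<partial>\<mu>) < \<epsilon> / 2"
    using add.IH(1)[of "\<epsilon> / 2"] add.prems by auto
  obtain g' where g': "tame V g'" "(\<integral>x. cmod (g x - g' x) \<partial>\<mu>) < \<epsilon> / 2"
    using add.IH(2)[of "\<epsilon> / 2"] add.prems by auto
  have int: "integrable \<mu> f'" "integrable \<mu> g'"
    using f' g' by (auto simp: tame_def)
  have "(\<integral>x. cmod (f x + g x - (f' x + g' x)) \<partial>\<mu>) \<le> (\<integral>x. cmod (f x - f' x) + cmod (g x - g' x) \<partial>\<mu>)"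
    using int add.hyps by (intro integral_mono) (auto simp: norm_diff_triangle_ineq)
  also have "\<dots> < \<epsilon>"
    using int add.hyps f' g' by simp
  finally show ?case
    using tame_add[OF V f'(1) g'(1)] by blast
next
  case (lim f s)
  have [measurable]: "f \<in> borel_measurable \<mu>" "\<And>i. s i \<in> borel_measurable \<mu>"
    using lim.hyps by auto
  have "(\<lambda>i. \<integral>x. cmod (f x - s i x) \<partial>\<mu>) \<longlonglongrightarrow> (\<integral>x. 0 \<partial>\<mu>)"
  \<comment> \<open>The induction rule supplies |s i x| \<le> 2 |f x|, hence the factor 3 for the
    difference.\<close>
  proof (rule integral_dominated_convergence[where w = "\<lambda>x. 3 * cmod (f x)"])
    show "AE x in \<mu>. (\<lambda>i. cmod (f x - s i x)) \<longlonglongrightarrow> 0"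
    proof (rule AE_I2)
      fix x assume "x \<in> space \<mu>"
      from tendsto_diff[OF tendsto_const[of "f x"] lim.hyps(2)[OF this]]
      show "(\<lambda>i. cmod (f x - s i x)) \<longlonglongrightarrow> 0"
        by (simp add: tendsto_norm_zero)
    qed
    show "AE x in \<mu>. norm (cmod (f x - s i x)) \<le> 3 * cmod (f x)" for i
    proof (rule AE_I2)
      fix x assume "x \<in> space \<mu>"
      from lim.hyps(3)[OF this, of i] norm_triangle_ineq4[of "f x" "s i x"]
      show "norm (cmod (f x - s i x)) \<le> 3 * cmod (f x)"
        by simp
    qed
  qed (use lim.hyps in auto)
  then obtain i where i: "(\<integral>x. cmod (f x - s i x) \<partial>\<mu>) < \<epsilon> / 2"
    using lim.prems by (auto dest!: LIMSEQ_D[of _ _ "\<epsilon> / 2"])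
  obtain g where g: "tame V g" "(\<integral>x. cmod (s i x - g x) \<partial>\<mu>) < \<epsilon> / 2"
    using lim.IH[of "\<epsilon> / 2" i] lim.prems by auto
  have int: "integrable \<mu> g"
    using g by (auto simp: tame_def)
  have "(\<integral>x. cmod (f x - g x) \<partial>\<mu>) \<le> (\<integral>x. cmod (f x - s i x) + cmod (s i x - g x) \<partial>\<mu>)"
    using int lim.hyps by (intro integral_mono)
      (auto intro: order_trans[OF _ norm_triangle_ineq[of "f _ - s i _" "s i _ - g _"]])
  also have "\<dots> < \<epsilon>"
    using int lim.hyps i g by simp
  finally show ?case
    using g by blast
qed

section \<open>A right identity forces discreteness\<close>

lemma integral_norm_indicator:
  assumes "U \<in> sets borel"
  shows "(\<integral>x. cmod (indicator U x) \<partial>\<mu>) = measure \<mu> U"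
proof -
  have "(\<integral>x. cmod (indicator U x) \<partial>\<mu>) = (\<integral>x. indicator U x \<partial>\<mu>)"
    by (intro Bochner_Integration.integral_cong) (auto simp: indicator_def)
  then show ?thesis
    using assms by simp
qed

text \<open>The product of two classes is a union over representatives. Since \<open>L\<^sup>1\<close> is assumed to be an
  algebra, this union is a single class, so one integrable convolution determines it.\<close>

lemma mult_L1_tame:
  assumes alg: "complex_banach_algebra (L1 \<mu>)"
    and V: "compact V" "open U" "U \<subseteq> V" and g: "tame V g"
  shows "L1_class \<mu> (indicator U) \<otimes>\<^bsub>L1 \<mu>\<^esub> L1_class \<mu> g = L1_class \<mu> (convolution \<mu> (indicator U) g)"
proof -
  let ?X = "L1_class \<mu> (indicator U) \<otimes>\<^bsub>L1 \<mu>\<^esub> L1_class \<mu> g"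
  have int: "integrable \<mu> (indicator U :: 'g \<Rightarrow> complex)" "integrable \<mu> g"
      "integrable \<mu> (convolution \<mu> (indicator U) g)"
    using integrable_indicator_open[OF V] V g by (auto simp: tame_def)
  then have "?X \<in> carrier (L1 \<mu>)"
    by (intro complex_banach_algebra.mult_closed[OF alg]) auto
  then obtain p where p: "integrable \<mu> p" "?X = L1_class \<mu> p"
    by (rule in_carrier_L1E)
  have "convolution \<mu> (indicator U) g \<in> ?X"
    unfolding mult_L1 using int L1_class_refl by blast
  then show ?thesis
    unfolding p(2) using p(1) int(3)
    by (subst L1_class_eq_iff) (simp_all add: mem_L1_class_iff del: Image_singleton_iff)
qed

text \<open>Write 1_U * g = 1_U + p, where p represents 1_U * (g - e). If M \<mu>(U) < 1/2, then |p|
  > 1/2 almost everywhere on U, so the norm of p exceeds \<mu>(U)/2. Since g, and with it M, is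
  fixed before U, the resulting bound is uniform over U.\<close>

lemma measure_bound_of_right_identity:
  assumes alg: "complex_banach_algebra (L1 \<mu>)"
    and E: "E \<in> carrier (L1 \<mu>)" "\<And>X. X \<in> carrier (L1 \<mu>) \<Longrightarrow> X \<otimes>\<^bsub>L1 \<mu>\<^esub> E = X"
    and V: "compact (V :: 'g set)"
  obtains M where "0 < M"
    "\<And>U :: 'g set. \<lbrakk>open U; U \<subseteq> V; U \<noteq> {}\<rbrakk> \<Longrightarrow> 1 \<le> M * measure \<mu> U"
proof -
  interpret A: complex_banach_algebra "L1 \<mu>" by (rule alg)
  obtain e where e: "integrable \<mu> e" "E = L1_class \<mu> e"
    using E(1) by (rule in_carrier_L1E)
  obtain g where g: "tame V g" "(\<integral>x. cmod (e x - g x) \<partial>\<mu>) < 1 / 2"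
    using tame_dense[OF V e(1), of "1 / 2"] by auto
  obtain M where M: "\<And>x. cmod (g x) \<le> M"
    using g by (auto simp: tame_def)
  have g_int: "integrable \<mu> g" and g_meas: "g \<in> borel_measurable borel"
    using g by (auto simp: tame_def dest: borel_measurable_integrable)
  have M0: "0 \<le> M"
    using M[of 0] norm_ge_zero order_trans by blast
  have "1 \<le> (2 * M + 1) * measure \<mu> U" if U: "open U" "U \<subseteq> V" "U \<noteq> {}" for U
  proof -
    let ?u = "indicator U :: 'g \<Rightarrow> complex" and ?m = "measure \<mu> U"
    have u_int: "integrable \<mu> ?u"
      by (rule integrable_indicator_open[OF V U(1,2)])
    have Ub [measurable]: "U \<in> sets borel"
      using U by simp
    have fin: "emeasure \<mu> U < \<infinity>"
      using compact_finite[OF V] emeasure_mono[of U V \<mu>] U V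
      by (auto intro: le_less_trans dest: compact_imp_closed)
    have pos: "0 < ?m"
      using emeasure_open_pos[OF U(1,3)] fin
      by (simp add: measure_def enn2real_positive_iff less_top zero_less_iff_neq_zero)
    define c where "c = convolution \<mu> ?u g"
    have c_int: "integrable \<mu> c"
      using g U by (simp add: c_def tame_def)
    have d_int: "integrable \<mu> (\<lambda>x. g x - e x)"
      using g_int e by auto
    have "L1_class \<mu> ?u \<otimes>\<^bsub>L1 \<mu>\<^esub> L1_class \<mu> (\<lambda>x. g x - e x) \<in> carrier (L1 \<mu>)"
      using u_int d_int by (intro A.mult_closed) auto
    then obtain p where p: "integrable \<mu> p"
      "L1_class \<mu> ?u \<otimes>\<^bsub>L1 \<mu>\<^esub> L1_class \<mu> (\<lambda>x. g x - e x) = L1_class \<mu> p"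
      by (rule in_carrier_L1E)
    have "L1_class \<mu> c = L1_class \<mu> ?u \<otimes>\<^bsub>L1 \<mu>\<^esub> L1_class \<mu> g"
      unfolding c_def by (rule mult_L1_tame[OF alg V U(1,2) g(1), symmetric])
    also have "L1_class \<mu> g = L1_class \<mu> (\<lambda>x. g x - e x) \<oplus>\<^bsub>L1 \<mu>\<^esub> L1_class \<mu> e"
      using d_int e by (simp add: add_L1)
    also have "L1_class \<mu> ?u \<otimes>\<^bsub>L1 \<mu>\<^esub> \<dots> = L1_class \<mu> p \<oplus>\<^bsub>L1 \<mu>\<^esub> L1_class \<mu> ?u"
      using A.mult_distr_r[of "L1_class \<mu> ?u" "L1_class \<mu> (\<lambda>x. g x - e x)" "L1_class \<mu> e"]
        u_int d_int e E(2)[of "L1_class \<mu> ?u"] p(2) by simp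
    also have "\<dots> = L1_class \<mu> (\<lambda>x. p x + ?u x)"
      by (rule add_L1[OF p(1) u_int])
    finally have AE: "AE x in \<mu>. c x = p x + ?u x"
      using c_int p(1) u_int by (simp add: L1_class_eq_iff)
    have "(\<integral>x. cmod (p x) \<partial>\<mu>) = nrm (L1 \<mu>) (L1_class \<mu> p)"
      using p by (simp add: nrm_L1)
    also have "\<dots> \<le> nrm (L1 \<mu>) (L1_class \<mu> ?u) * nrm (L1 \<mu>) (L1_class \<mu> (\<lambda>x. g x - e x))"
      unfolding p(2)[symmetric] using u_int d_int by (intro A.nrm_mult) auto
    also have "\<dots> = ?m * (\<integral>x. cmod (e x - g x) \<partial>\<mu>)"
      using u_int d_int by (simp add: nrm_L1 integral_norm_indicator norm_minus_commute)
    also have "\<dots> \<le> ?m * (1 / 2)"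
      using g(2) pos by (intro mult_left_mono) auto
    finally have p_le: "(\<integral>x. cmod (p x) \<partial>\<mu>) \<le> ?m / 2"
      by simp
    have c_le: "cmod (c x) \<le> M * ?m" for x
    proof -
      have "cmod (c x) \<le> (\<integral>y. M * indicator U y \<partial>\<mu>)"
        unfolding c_def convolution_def
      proof (rule order_trans[OF integral_norm_bound integral_mono])
        show "integrable \<mu> (\<lambda>y. cmod (?u y * g (- y + x)))"
          by (rule integrable_norm, rule integrable_convolution_integrand[OF V U(1,2) g_meas M])
        show "integrable \<mu> (\<lambda>y. M * indicator U y)"
          using fin by simp
        show "cmod (?u y * g (- y + x)) \<le> M * indicator U y" for y
          using M by (auto simp: indicator_def)
      qed
      then show ?thesis
        using Ub by simp
    qed
    \<comment> \<open>On U, c = p + 1 and |c| \<le> M \<mu>(U) give |p| \<ge> 1 - M \<mu>(U) almost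
      everywhere; this is integrated over U.\<close>
    have "(1 - M * ?m) * ?m = (\<integral>x. (1 - M * ?m) * indicator U x \<partial>\<mu>)"
      by simp
    also have "\<dots> \<le> (\<integral>x. cmod (p x) \<partial>\<mu>)"
    proof (rule integral_mono_AE)
      show "integrable \<mu> (\<lambda>x. (1 - M * ?m) * indicator U x)"
        using fin by simp
      show "integrable \<mu> (\<lambda>x. cmod (p x))"
        using p by simp
      show "AE x in \<mu>. (1 - M * ?m) * indicator U x \<le> cmod (p x)"
        using AE
      proof eventually_elim
        case (elim x)
        show ?case
        proof (cases "x \<in> U")
          case True
          have "1 \<le> cmod (c x) + cmod (p x)"
            using elim True norm_triangle_ineq4[of "c x" "p x"] by simp
          with c_le[of x] True show ?thesis
            by simp
        qed simp
      qed
    qed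
    finally have "(1 - M * ?m) * ?m \<le> 1 / 2 * ?m"
      using p_le by simp
    then have "1 - M * ?m \<le> 1 / 2"
      using pos by (simp add: mult_le_cancel_right)
    then show ?thesis
      using pos by (simp add: algebra_simps)
  qed
  \<comment> \<open>The estimate gives 1 \<le> 2 M \<mu>(U); adding 1 to the constant makes its
    positivity immediate, as only M \<ge> 0 is known.\<close>
  then show thesis
    using that[of "2 * M + 1"] M0 by simp
qed

text \<open>Outer regularity passes the uniform lower bound from neighbourhoods of 0 to the point 0,
  and translation passes it to every point. A compact set has finite measure, hence room for only
  finitely many such points.\<close>

lemma open_singleton_of_right_identity:
  assumes alg: "complex_banach_algebra (L1 \<mu>)"
    and E: "E \<in> carrier (L1 \<mu>)" "\<And>X. X \<in> carrier (L1 \<mu>) \<Longrightarrow> X \<otimes>\<^bsub>L1 \<mu>\<^esub> E = X"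
    and V: "compact (V :: 'g set)" "open W" "0 \<in> W" "W \<subseteq> V"
  shows "open {x :: 'g}"
proof -
  obtain M where M: "0 < M" "\<And>U :: 'g set. \<lbrakk>open U; U \<subseteq> V; U \<noteq> {}\<rbrakk> \<Longrightarrow> 1 \<le> M * measure \<mu> U"
    using measure_bound_of_right_identity[OF alg E V(1)] by blast
  have Vb: "V \<in> sets borel"
    using V by (simp add: compact_imp_closed)
  have fin: "emeasure \<mu> V < \<infinity>"
    by (rule compact_finite[OF V(1)])
  have zero: "ennreal (1 / M) \<le> emeasure \<mu> {0}"
  proof -
    have "ennreal (1 / M) \<le> emeasure \<mu> U" if U: "open U" "{0} \<subseteq> U" for U
    proof -
      \<comment> \<open>The bound applies only inside \<open>V\<close>, so an arbitrary
        neighbourhood of 0 is first cut down by \<open>W\<close>.\<close>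
      have UW: "open (U \<inter> W)" "U \<inter> W \<subseteq> V" "U \<inter> W \<noteq> {}"
        using U V by auto
      have "emeasure \<mu> (U \<inter> W) < \<infinity>"
        using le_less_trans[OF emeasure_mono[OF UW(2)] fin] Vb by simp
      then have "emeasure \<mu> (U \<inter> W) = ennreal (measure \<mu> (U \<inter> W))"
        by (simp add: emeasure_eq_ennreal_measure less_top)
      moreover have "1 / M \<le> measure \<mu> (U \<inter> W)"
        using M(2)[OF UW] M(1) by (simp add: field_simps)
      ultimately have "ennreal (1 / M) \<le> emeasure \<mu> (U \<inter> W)"
        by (simp add: ennreal_leI)
      also have "\<dots> \<le> emeasure \<mu> U"
        using U by (intro emeasure_mono) auto
      finally show ?thesis .
    qed
    then show ?thesis
      by (subst outer_regular) (auto intro!: INF_greatest)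
  qed
  have point: "emeasure \<mu> {a} = emeasure \<mu> {0}" for a
    using emeasure_translate[of "{0}" a] by simp
  have "finite V"
  proof (rule ccontr)
    assume inf: "infinite V"
    have "ennreal (real n / M) \<le> emeasure \<mu> V" for n
    proof -
      obtain F where F: "F \<subseteq> V" "finite F" "card F = n"
        using infinite_arbitrarily_large[OF inf] by blast
      have "ennreal (real n / M) = (\<Sum>a\<in>F. ennreal (1 / M))"
        using F M(1) by (subst sum_ennreal) auto
      also have "\<dots> \<le> (\<Sum>a\<in>F. emeasure \<mu> {a})"
        using zero by (intro sum_mono) (metis point)
      also have "\<dots> = emeasure \<mu> F"
        using F by (intro emeasure_eq_sum_singleton[symmetric]) auto
      also have "\<dots> \<le> emeasure \<mu> V"
        using F Vb by (intro emeasure_mono) auto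
      finally show ?thesis .
    qed
    moreover have "emeasure \<mu> V = ennreal (measure \<mu> V)"
      using fin by (intro emeasure_eq_ennreal_measure) simp
    ultimately have "real n / M \<le> measure \<mu> V" for n
      using ennreal_le_iff[OF measure_nonneg] by metis
    moreover obtain n where "measure \<mu> V * M < real n"
      using reals_Archimedean2 by blast
    ultimately show False
      using M(1) by (metis leD pos_divide_le_eq)
  qed
  \<comment> \<open>In a Hausdorff space finite sets are closed, so the other points of the open set
    \<open>W\<close> can be removed, leaving {0} open.\<close>
  then have "finite (W - {0})"
    using V finite_subset by blast
  then have "open (W - (W - {0}))"
    using V by (intro open_Diff finite_imp_closed) auto
  moreover have "W - (W - {0}) = {0}"
    using V by auto
  ultimately have "open {0 :: 'g}"
    by simp
  from open_translate[OF this, of x] show ?thesis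
    by simp
qed

section \<open>Cardinality of the universe\<close>

lemma exists_integrable_nonnull:
  obtains f :: "'g \<Rightarrow> complex" where "integrable \<mu> f" "\<not> (AE x in \<mu>. f x = 0)"
proof -
  obtain K where K: "compact K" "emeasure \<mu> K \<noteq> 0"
    using exists_compact_nonnull by blast
  have Kb: "K \<in> sets borel"
    using K by (simp add: compact_imp_closed)
  show thesis
  proof
    show "integrable \<mu> (\<lambda>x. indicator K x *\<^sub>R (1 :: complex))"
      using compact_finite[OF K(1)] Kb by (intro integrableI_bounded_set_indicator[of _ _ _ 1]) auto
    show "\<not> (AE x in \<mu>. indicator K x *\<^sub>R (1 :: complex) = 0)"
      using K(2) Kb by (subst AE_iff_measurable[of K]) (auto simp: indicator_def)
  qed
qed

text \<open>The complex multiples of one nonzero class embed C into L1, so L1 is infinite and at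
  least as large as C; an infinite cardinal absorbs such a factor. This makes room in
  \<open>'u\<close> for the unitization.\<close>

lemma inj_L1_times_complex:
  includes cardinal_syntax
  shows "\<exists>\<theta> :: ('g \<Rightarrow> complex) set \<times> complex \<Rightarrow> ('g \<Rightarrow> complex) set.
    inj_on \<theta> (carrier (L1 \<mu>) \<times> UNIV) \<and> \<theta> ` (carrier (L1 \<mu>) \<times> UNIV) \<subseteq> carrier (L1 \<mu>)"
proof -
  obtain f :: "'g \<Rightarrow> complex" where f: "integrable \<mu> f" "\<not> (AE x in \<mu>. f x = 0)"
    by (rule exists_integrable_nonnull)
  have inj: "inj (\<lambda>c. L1_class \<mu> (\<lambda>x. c * f x))"
  proof (rule injI)
    fix c d assume "L1_class \<mu> (\<lambda>x. c * f x) = L1_class \<mu> (\<lambda>x. d * f x)"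
    then have "AE x in \<mu>. c * f x = d * f x"
      using f by (subst (asm) L1_class_eq_iff) auto
    then show "c = d"
      using f(2) by (auto elim: eventually_mono)
  qed
  have sub: "range (\<lambda>c. L1_class \<mu> (\<lambda>x. c * f x)) \<subseteq> carrier (L1 \<mu>)"
    using f by auto
  then have "infinite (carrier (L1 \<mu>))"
    using inj infinite_UNIV_char_0 finite_subset finite_imageD by metis
  moreover have "|UNIV :: complex set| \<le>o |carrier (L1 \<mu>)|"
    using inj sub card_of_ordLeq by blast
  ultimately have "|carrier (L1 \<mu>) \<times> (UNIV :: complex set)| =o |carrier (L1 \<mu>)|"
    using card_of_Times_infinite by blast
  then show ?thesis
    using card_of_ordLeq ordIso_imp_ordLeq by blast
qed

end

section \<open>Unital algebras are 0-injective\<close>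

lemma bounded_ops_closed: "\<lbrakk>T \<in> bounded_ops E F; x \<in> carrier E\<rbrakk> \<Longrightarrow> T x \<in> carrier F"
  by (auto simp: bounded_ops_def)

lemma bounded_ops_compose:
  assumes D: "complex_banach_space D" and E: "complex_banach_space E"
    and S: "S \<in> bounded_ops D E" and R: "R \<in> bounded_ops E F"
  shows "compose (carrier D) R S \<in> bounded_ops D F"
proof -
  interpret D: complex_banach_space D by (rule D)
  interpret E: complex_banach_space E by (rule E)
  note S' = bounded_ops_closed[OF S] and R' = bounded_ops_closed[OF R]
  obtain C where C: "\<And>x. x \<in> carrier D \<Longrightarrow> nrm E (S x) \<le> C * nrm D x"
    using S unfolding bounded_ops_def by blast
  obtain C' where C': "\<And>x. x \<in> carrier E \<Longrightarrow> nrm F (R x) \<le> C' * nrm E x"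
    using R unfolding bounded_ops_def by blast
  \<comment> \<open>The constants in \<open>bounded_ops\<close> carry no sign condition; the
    absolute value keeps multiplication by the outer one monotone.\<close>
  have bound: "nrm F (R (S x)) \<le> (\<bar>C'\<bar> * C) * nrm D x" if "x \<in> carrier D" for x
  proof -
    have "nrm F (R (S x)) \<le> C' * nrm E (S x)"
      using C' S' that by blast
    also have "\<dots> \<le> \<bar>C'\<bar> * nrm E (S x)"
      using E.nrm_nonneg S' that by (simp add: mult_right_mono)
    also have "\<dots> \<le> \<bar>C'\<bar> * (C * nrm D x)"
      using C[OF that] by (simp add: mult_left_mono)
    finally show ?thesis
      by (simp add: mult.assoc)
  qed
  have S_lin: "\<And>x y. \<lbrakk>x \<in> carrier D; y \<in> carrier D\<rbrakk> \<Longrightarrow> S (x \<oplus>\<^bsub>D\<^esub> y) = S x \<oplus>\<^bsub>E\<^esub> S y"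
      "\<And>c x. x \<in> carrier D \<Longrightarrow> S (c \<odot>\<^bsub>D\<^esub> x) = c \<odot>\<^bsub>E\<^esub> S x"
    using S by (auto simp: bounded_ops_def)
  have R_lin: "\<And>x y. \<lbrakk>x \<in> carrier E; y \<in> carrier E\<rbrakk> \<Longrightarrow> R (x \<oplus>\<^bsub>E\<^esub> y) = R x \<oplus>\<^bsub>F\<^esub> R y"
      "\<And>c x. x \<in> carrier E \<Longrightarrow> R (c \<odot>\<^bsub>E\<^esub> x) = c \<odot>\<^bsub>F\<^esub> R x"
    using R by (auto simp: bounded_ops_def)
  have smult: "c \<odot>\<^bsub>D\<^esub> x \<in> carrier D" if "x \<in> carrier D" for x c
    using D.smult_closed that by simp
  show ?thesis
    unfolding bounded_ops_def mem_Collect_eq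
  proof (intro conjI ballI allI exI[of _ "\<bar>C'\<bar> * C"])
    show "compose (carrier D) R S \<in> carrier D \<rightarrow>\<^sub>E carrier F"
      using S' R' by (auto simp: compose_def)
  qed (simp_all add: compose_def S_lin R_lin S' smult bound)
qed

lemma act_bounded_op:
  assumes K: "banach_left_module A K" and e: "e \<in> carrier A"
  shows "(\<lambda>k\<in>carrier K. act K e k) \<in> bounded_ops K K"
proof -
  interpret K: banach_left_module A K by (rule K)
  obtain C where C: "\<And>a x. \<lbrakk>a \<in> carrier A; x \<in> carrier K\<rbrakk>
      \<Longrightarrow> nrm K (act K a x) \<le> C * nrm A a * nrm K x"
    using K.act_bounded by blast
  have smult: "c \<odot>\<^bsub>K\<^esub> x \<in> carrier K" if "x \<in> carrier K" for x c
    using K.smult_closed that by simp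
  show ?thesis
    unfolding bounded_ops_def mem_Collect_eq
    by (intro conjI ballI allI exI[of _ "C * nrm A e"])
      (auto simp: e K.act_closed K.act_distr_r K.act_smult_r smult C)
qed

text \<open>If \<open>S\<close> is a bounded left inverse of the admissible monomorphism \<open>T\<close> and \<open>e\<close> is the
  identity of the algebra, then \<open>R\<close> extends along \<open>T\<close> to \<open>k \<mapsto> R (S (e \<cdot> k))\<close>.\<close>

lemma zero_injective_of_identity:
  fixes A :: "'a normed_module"
  assumes alg: "complex_banach_algebra A"
    and e: "e \<in> carrier A"
      "\<And>a. a \<in> carrier A \<Longrightarrow> e \<otimes>\<^bsub>A\<^esub> a = a" "\<And>a. a \<in> carrier A \<Longrightarrow> a \<otimes>\<^bsub>A\<^esub> e = a"
  shows "zero_injective TYPE('u) A (regular_module A)"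
  unfolding zero_injective_def
proof (intro conjI allI impI)
  show "banach_left_module A (regular_module A)"
    by (rule banach_left_module_regular[OF alg])
  fix F K :: "('a, 'u) left_module" and T
  assume "banach_left_module A F \<and> banach_left_module A K \<and>
      T \<in> module_ops A F K \<and> inj_on T (carrier F) \<and> admissible F K T \<and>
      action_span A K \<subseteq> T ` carrier F"
  then have modF: "banach_left_module A F" and modK: "banach_left_module A K"
    and T: "T \<in> module_ops A F K" and inj: "inj_on T (carrier F)"
    and adm: "admissible F K T" and span: "action_span A K \<subseteq> T ` carrier F"
    by auto
  interpret F: banach_left_module A F by (rule modF)
  interpret K: banach_left_module A K by (rule modK)
  have banachF: "complex_banach_space F" and banachK: "complex_banach_space K"
    using modF modK by (simp_all add: banach_left_module_def)
  interpret A: complex_banach_algebra A by (rule alg)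
  have T_op: "T \<in> bounded_ops F K"
    and T_act: "\<And>a x. \<lbrakk>a \<in> carrier A; x \<in> carrier F\<rbrakk> \<Longrightarrow> T (act F a x) = act K a (T x)"
    using T by (auto simp: module_ops_def)
  note T_closed = bounded_ops_closed[OF T_op]
  obtain S where S: "S \<in> bounded_ops K F"
    and TST: "compose (carrier F) T (compose (carrier F) S T) = T"
    using adm by (auto simp: admissible_def)
  \<comment> \<open>TST = T and injectivity of T make S a left inverse.\<close>
  have ST: "S (T x) = x" if x: "x \<in> carrier F" for x
  proof -
    have "T (S (T x)) = T x"
      using fun_cong[OF TST, of x] x by (simp add: compose_def)
    moreover have "S (T x) \<in> carrier F"
      by (intro bounded_ops_closed[OF S] T_closed x)
    ultimately show ?thesis
      using inj x by (auto dest: inj_onD)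
  qed
  have image: "\<exists>f\<in>carrier F. act K e k = T f" if "k \<in> carrier K" for k
  proof -
    have "act K e k \<in> action_span A K"
      unfolding action_span_def vspan_def using e(1) that by (intro hull_inc) blast
    with span show ?thesis
      by blast
  qed
  show "(\<lambda>R. compose (carrier F) R T) ` module_ops A K (regular_module A)
      = module_ops A F (regular_module A)"
  proof (intro equalityI subsetI)
    fix Q assume "Q \<in> (\<lambda>R. compose (carrier F) R T) ` module_ops A K (regular_module A)"
    then obtain R where R: "R \<in> module_ops A K (regular_module A)"
      and Q: "Q = compose (carrier F) R T"
      by auto
    have "Q \<in> bounded_ops F (regular_module A)"
      unfolding Q using R T_op
      by (intro bounded_ops_compose[OF banachF banachK]) (auto simp: module_ops_def)
    then show "Q \<in> module_ops A F (regular_module A)"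
      using R T_closed T_act by (auto simp: module_ops_def Q compose_def F.act_closed)
  next
    fix R assume R: "R \<in> module_ops A F (regular_module A)"
    then have R_op: "R \<in> bounded_ops F (regular_module A)"
      and R_act: "\<And>a x. \<lbrakk>a \<in> carrier A; x \<in> carrier F\<rbrakk> \<Longrightarrow> R (act F a x) = a \<otimes>\<^bsub>A\<^esub> R x"
      by (auto simp: module_ops_def)
    have R_closed: "R x \<in> carrier A" if "x \<in> carrier F" for x
      using bounded_ops_closed[OF R_op that] by simp
    \<comment> \<open>S alone need not be a morphism. On the image of T it inverts a morphism, and
      multiplication by e moves every k into that image.\<close>
    define R' where "R' = compose (carrier K) R (compose (carrier K) S (\<lambda>k\<in>carrier K. act K e k))"
    have R'_eq: "R' k = R (S (act K e k))" if "k \<in> carrier K" for k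
      using that by (simp add: R'_def compose_def)
    have "R' \<in> bounded_ops K (regular_module A)"
      unfolding R'_def
      by (intro bounded_ops_compose[OF banachK banachF _ R_op]
          bounded_ops_compose[OF banachK banachK _ S]
          act_bounded_op[OF modK e(1)])
    moreover have "R' (act K a k) = a \<otimes>\<^bsub>A\<^esub> R' k" if a: "a \<in> carrier A" and k: "k \<in> carrier K" for a k
    proof -
      obtain f where f: "f \<in> carrier F" "act K e k = T f"
        using image[OF k] by blast
      \<comment> \<open>Both sides equal ak, as ea = a = ae. This is where the identity must be
        two-sided.\<close>
      have "act K e (act K a k) = act K a (act K e k)"
        using a k e by (simp add: K.act_assoc[symmetric])
      also have "\<dots> = T (act F a f)"
        using a f by (simp add: T_act)
      finally show ?thesis
        using a k f by (simp add: R'_eq K.act_closed ST F.act_closed R_act)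
    qed
    ultimately have R': "R' \<in> module_ops A K (regular_module A)"
      by (simp add: module_ops_def)
    have R'_T: "R = compose (carrier F) R' T"
    proof (rule sym)
      show "compose (carrier F) R' T = R"
      proof
        fix x show "compose (carrier F) R' T x = R x"
        proof (cases "x \<in> carrier F")
          case True
          \<comment> \<open>The module F need not be unital, so e x may differ from x. The factor e
            disappears only after R has moved it into the algebra: R(e x) = e R(x) = R(x).\<close>
          then have "compose (carrier F) R' T x = R (S (T (act F e x)))"
            by (simp add: compose_def R'_eq T_closed T_act e)
          also have "\<dots> = e \<otimes>\<^bsub>A\<^esub> R x"
            using True e by (simp add: ST F.act_closed R_act)
          finally show ?thesis
            using True e R_closed by simp
        next
          case False
          have "R \<in> extensional (carrier F)"
            using R_op by (auto simp: bounded_ops_def PiE_def)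
          from extensional_arb[OF this False] False show ?thesis
            by (simp add: compose_def)
        qed
      qed
    qed
    show "R \<in> (\<lambda>R. compose (carrier F) R T) ` module_ops A K (regular_module A)"
      by (rule image_eqI[where x = R', OF _ R']) (rule R'_T)
  qed
qed

section \<open>The group algebra of a discrete group\<close>

text \<open>The form Haar measure takes on a discrete group, with c the mass of a point. Almost
  everywhere means everywhere, classes are singletons, and integrals of summable functions are c
  times unordered sums.\<close>

locale scaled_counting =
  fixes \<mu> :: "'g :: group_add measure" and c :: real
  assumes c_pos: "0 < c" and \<mu>_eq: "\<mu> = density (count_space UNIV) (\<lambda>_. ennreal c)"
begin

lemma integrable_iff:
  fixes f :: "'g \<Rightarrow> 'b :: {banach, second_countable_topology}"
  shows "integrable \<mu> f \<longleftrightarrow> (\<lambda>x. norm (f x)) summable_on UNIV"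
proof -
  have "integrable \<mu> f \<longleftrightarrow> integrable (count_space UNIV) (\<lambda>x. c *\<^sub>R f x)"
    unfolding \<mu>_eq using c_pos by (subst integrable_density) auto
  also have "\<dots> \<longleftrightarrow> integrable (count_space UNIV) f"
    using integrable_scaleR_right[of "inverse c" "count_space UNIV" "\<lambda>x. c *\<^sub>R f x"] c_pos
    by auto
  also have "\<dots> \<longleftrightarrow> Infinite_Set_Sum.abs_summable_on f UNIV"
    by (simp add: Infinite_Set_Sum.abs_summable_on_def)
  finally show ?thesis
    by (simp add: abs_summable_equivalent)
qed

lemma integral_eq:
  fixes f :: "'g \<Rightarrow> 'b :: {banach, second_countable_topology}"
  assumes "(\<lambda>x. norm (f x)) summable_on UNIV"
  shows "integral\<^sup>L \<mu> f = c *\<^sub>R infsum f UNIV"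
proof -
  have "integral\<^sup>L \<mu> f = c *\<^sub>R infsetsum f UNIV"
    unfolding \<mu>_eq using c_pos by (subst integral_density) (auto simp: infsetsum_def)
  then show ?thesis
    using assms by (simp add: infsetsum_infsum abs_summable_equivalent[symmetric])
qed

lemma AE_iff: "(AE x in \<mu>. P x) \<longleftrightarrow> (\<forall>x. P x)"
  unfolding \<mu>_eq using c_pos by (simp add: AE_density AE_count_space)

lemma L1_class_eq: "integrable \<mu> f \<Longrightarrow> L1_class \<mu> f = {f}"
  by (auto simp: L1_rel_def AE_iff)

end

section \<open>Convolution of absolutely summable functions\<close>

text \<open>The substitution u = y, v = -y + x, which separates the variables in f(y) g(-y +
  x).\<close>

lemma bij_convolution: "bij (\<lambda>p :: 'g \<times> 'g :: group_add. (snd p, - snd p + fst p))"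
  by (rule bij_betw_byWitness[where f' = "\<lambda>p. (fst p + snd p, fst p)"])
    (auto simp: add.assoc[symmetric])

text \<open>After this substitution the double family is f(u) g(v), whose norms sum to the product
  of the two sums.\<close>

lemma
  fixes f g :: "'g :: group_add \<Rightarrow> complex"
  assumes f: "(\<lambda>x. norm (f x)) summable_on UNIV" and g: "(\<lambda>x. norm (g x)) summable_on UNIV"
  shows summable_convolution_pairs:
      "(\<lambda>p. norm (f (snd p) * g (- snd p + fst p))) summable_on (UNIV \<times> UNIV)" (is ?summable)
    and infsum_convolution_norm:
      "(\<Sum>\<^sub>\<infinity>x. \<Sum>\<^sub>\<infinity>y. norm (f y * g (- y + x))) = (\<Sum>\<^sub>\<infinity>x. norm (f x)) * (\<Sum>\<^sub>\<infinity>x. norm (g x))" (is ?eq)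
proof -
  let ?h = "\<lambda>p :: 'g \<times> 'g. (snd p, - snd p + fst p)"
  have "(\<lambda>p. norm (f (fst p) * g (snd p))) summable_on (UNIV \<times> UNIV)"
    using f g
    by (subst Infinite_Sum.abs_summable_on_Sigma_iff)
      (auto simp: norm_mult infsum_cmult_right' abs_mult infsum_nonneg
        intro!: summable_on_cmult_right summable_on_cmult_left)
  then have pairs: "(\<lambda>p. norm (f (fst p) * g (snd p))) summable_on UNIV"
    by simp
  show summable: ?summable
    using summable_on_reindex_bij_betw[OF bij_convolution, of "\<lambda>p. norm (f (fst p) * g (snd p))"] pairs
    by simp
  have "(\<Sum>\<^sub>\<infinity>x. \<Sum>\<^sub>\<infinity>y. norm (f y * g (- y + x)))
      = (\<Sum>\<^sub>\<infinity>p\<in>UNIV \<times> UNIV. norm (f (snd p) * g (- snd p + fst p)))"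
    using infsum_Sigma_banach[OF summable] by simp
  also have "\<dots> = (\<Sum>\<^sub>\<infinity>p\<in>UNIV \<times> UNIV. norm (f (fst p) * g (snd p)))"
    using infsum_reindex_bij_betw[OF bij_convolution, of "\<lambda>p. norm (f (fst p) * g (snd p))"]
    by simp
  also have "\<dots> = (\<Sum>\<^sub>\<infinity>x. \<Sum>\<^sub>\<infinity>y. norm (f x * g y))"
    using infsum_Sigma_banach[of "\<lambda>p. norm (f (fst p) * g (snd p))" UNIV "\<lambda>_. UNIV"] pairs by simp
  also have "\<dots> = (\<Sum>\<^sub>\<infinity>x. norm (f x)) * (\<Sum>\<^sub>\<infinity>x. norm (g x))"
    by (simp add: norm_mult infsum_cmult_right' infsum_cmult_left')
  finally show ?eq .
qed

context scaled_counting
begin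

context
  fixes f g :: "'g \<Rightarrow> complex"
  assumes f: "(\<lambda>x. norm (f x)) summable_on UNIV" and g: "(\<lambda>x. norm (g x)) summable_on UNIV"
begin

lemma summable_convolution_integrand: "(\<lambda>y. norm (f y * g (- y + x))) summable_on UNIV"
  using summable_convolution_pairs[OF f g, THEN Infinite_Sum.abs_summable_on_Sigma_iff[THEN iffD1]] by auto

lemma convolution_eq: "convolution \<mu> f g x = c * (\<Sum>\<^sub>\<infinity>y. f y * g (- y + x))"
  unfolding convolution_def integral_eq[OF summable_convolution_integrand]
  by (simp add: scaleR_conv_of_real)

lemma norm_convolution_le:
  "norm (convolution \<mu> f g x) \<le> c * (\<Sum>\<^sub>\<infinity>y. norm (f y * g (- y + x)))"
  unfolding convolution_eq
  using norm_infsum_bound[OF summable_convolution_integrand, of x] c_pos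
  by (simp add: norm_mult)

lemma summable_infsum_norm: "(\<lambda>x. \<Sum>\<^sub>\<infinity>y. norm (f y * g (- y + x))) summable_on UNIV"
  using summable_convolution_pairs[OF f g, THEN Infinite_Sum.abs_summable_on_Sigma_iff[THEN iffD1]]
  by (auto simp: infsum_nonneg)

lemma summable_convolution: "(\<lambda>x. norm (convolution \<mu> f g x)) summable_on UNIV"
  by (rule summable_on_comparison_test[OF summable_on_cmult_right[OF summable_infsum_norm, of c]])
    (auto intro: norm_convolution_le)

lemma infsum_norm_convolution_le:
  "(\<Sum>\<^sub>\<infinity>x. norm (convolution \<mu> f g x)) \<le> c * ((\<Sum>\<^sub>\<infinity>x. norm (f x)) * (\<Sum>\<^sub>\<infinity>x. norm (g x)))"
proof -
  have "(\<Sum>\<^sub>\<infinity>x. norm (convolution \<mu> f g x)) \<le> (\<Sum>\<^sub>\<infinity>x. c * (\<Sum>\<^sub>\<infinity>y. norm (f y * g (- y + x))))"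
    by (intro infsum_mono summable_convolution summable_on_cmult_right summable_infsum_norm
        norm_convolution_le)
  then show ?thesis
    by (simp add: infsum_cmult_right' infsum_convolution_norm[OF f g])
qed

end

text \<open>Both sides are iterated sums of one absolutely summable family of pairs. It is dominated
  by the family for f and g times a bound for h, so the order of summation may be exchanged.\<close>

lemma convolution_assoc:
  fixes f g h :: "'g \<Rightarrow> complex"
  assumes f: "(\<lambda>x. norm (f x)) summable_on UNIV" and g: "(\<lambda>x. norm (g x)) summable_on UNIV"
    and h: "(\<lambda>x. norm (h x)) summable_on UNIV"
  shows "convolution \<mu> (convolution \<mu> f g) h = convolution \<mu> f (convolution \<mu> g h)"
proof
  fix x
  \<comment> \<open>A summable function is bounded by its sum of norms, since each single term
    is.\<close>
  have h_le: "norm (h u) \<le> (\<Sum>\<^sub>\<infinity>v. norm (h v))" for u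
    using finite_sum_le_infsum[OF h, of "{u}"] by simp
  let ?F = "\<lambda>p. f (snd p) * g (- snd p + fst p) * h (- fst p + x)"
  have "(\<lambda>p. norm (?F p)) summable_on UNIV \<times> UNIV"
  proof (rule summable_on_comparison_test)
    show "(\<lambda>p. norm (f (snd p) * g (- snd p + fst p)) * (\<Sum>\<^sub>\<infinity>v. norm (h v))) summable_on UNIV \<times> UNIV"
      by (intro summable_on_cmult_left summable_convolution_pairs[OF f g])
    show "norm (?F p) \<le> norm (f (snd p) * g (- snd p + fst p)) * (\<Sum>\<^sub>\<infinity>v. norm (h v))" for p
      unfolding norm_mult by (intro mult_left_mono h_le) auto
  qed auto
  then have sum: "?F summable_on UNIV \<times> UNIV"
    by (rule abs_summable_summable)
  have "convolution \<mu> (convolution \<mu> f g) h x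
      = c * (\<Sum>\<^sub>\<infinity>z. (c * (\<Sum>\<^sub>\<infinity>y. f y * g (- y + z))) * h (- z + x))"
    by (subst convolution_eq[OF summable_convolution[OF f g] h]) (simp only: convolution_eq[OF f g])
  also have "\<dots> = c * (c * (\<Sum>\<^sub>\<infinity>z. \<Sum>\<^sub>\<infinity>y. f y * g (- y + z) * h (- z + x)))"
    by (simp only: infsum_cmult_right' infsum_cmult_left' mult.assoc[of "complex_of_real c"])
  also have "(\<Sum>\<^sub>\<infinity>z. \<Sum>\<^sub>\<infinity>y. f y * g (- y + z) * h (- z + x))
      = (\<Sum>\<^sub>\<infinity>y. \<Sum>\<^sub>\<infinity>z. f y * g (- y + z) * h (- z + x))"
    using sum by (intro infsum_swap_banach) (simp add: case_prod_beta')
  \<comment> \<open>Substitute z = y + w for fixed y.\<close>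
  also have "\<dots> = (\<Sum>\<^sub>\<infinity>y. \<Sum>\<^sub>\<infinity>w. f y * g w * h (- w + (- y + x)))"
  proof (rule infsum_cong)
    fix y :: 'g
    have "bij ((+) y)"
      by (rule bij_betw_byWitness[where f' = "(+) (- y)"]) (auto simp: add.assoc[symmetric])
    from infsum_reindex_bij_betw[OF this, of "\<lambda>z. f y * g (- y + z) * h (- z + x)"]
    show "(\<Sum>\<^sub>\<infinity>z. f y * g (- y + z) * h (- z + x)) = (\<Sum>\<^sub>\<infinity>w. f y * g w * h (- w + (- y + x)))"
      by (simp add: add.assoc[symmetric] minus_add)
  qed
  also have "c * (c * \<dots>) = c * (\<Sum>\<^sub>\<infinity>y. f y * (c * (\<Sum>\<^sub>\<infinity>w. g w * h (- w + (- y + x)))))"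
    by (simp only: infsum_cmult_right' mult.assoc mult.left_commute[of "f _" "complex_of_real c"])
  also have "\<dots> = convolution \<mu> f (convolution \<mu> g h) x"
    by (subst convolution_eq[OF f summable_convolution[OF g h]]) (simp only: convolution_eq[OF g h])
  finally show "convolution \<mu> (convolution \<mu> f g) h x = convolution \<mu> f (convolution \<mu> g h) x" .
qed

lemma integrable_convolution:
  "\<lbrakk>integrable \<mu> f; integrable \<mu> g\<rbrakk> \<Longrightarrow> integrable \<mu> (convolution \<mu> f g)"
  unfolding integrable_iff by (rule summable_convolution)

lemma mult_L1_class:
  assumes "integrable \<mu> f" "integrable \<mu> g"
  shows "L1_class \<mu> f \<otimes>\<^bsub>L1 \<mu>\<^esub> L1_class \<mu> g = L1_class \<mu> (convolution \<mu> f g)"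
  unfolding mult_L1 using assms by (simp add: L1_class_eq del: Image_singleton_iff)

lemma complex_banach_algebra_L1: "complex_banach_algebra (L1 \<mu>)"
proof -
  interpret L: complex_banach_space "L1 \<mu>"
    by (rule complex_banach_space_L1)
  have int: "integrable \<mu> (\<lambda>y. f y * g (- y + x))" if "integrable \<mu> f" "integrable \<mu> g"
    for f g :: "'g \<Rightarrow> complex" and x
    using summable_convolution_integrand that unfolding integrable_iff by blast
  show ?thesis
  proof
    fix X Y assume "X \<in> carrier (L1 \<mu>)" "Y \<in> carrier (L1 \<mu>)"
    then obtain f g where fg: "integrable \<mu> f" "X = L1_class \<mu> f" "integrable \<mu> g" "Y = L1_class \<mu> g"
      by (metis in_carrier_L1E)
    show "X \<otimes>\<^bsub>L1 \<mu>\<^esub> Y \<in> carrier (L1 \<mu>)"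
      using fg by (simp add: mult_L1_class integrable_convolution)
    \<comment> \<open>The norm of L1 is c times the sum of norms. Convolution contributes one
      further c, so the right side carries one factor for each of f and g.\<close>
    have "c * (\<Sum>\<^sub>\<infinity>x. norm (convolution \<mu> f g x))
        \<le> c * (c * ((\<Sum>\<^sub>\<infinity>x. norm (f x)) * (\<Sum>\<^sub>\<infinity>x. norm (g x))))"
      using fg c_pos by (intro mult_left_mono infsum_norm_convolution_le) (auto simp: integrable_iff)
    then show "nrm (L1 \<mu>) (X \<otimes>\<^bsub>L1 \<mu>\<^esub> Y) \<le> nrm (L1 \<mu>) X * nrm (L1 \<mu>) Y"
      using fg summable_convolution[of f g]
      by (simp add: mult_L1_class integrable_convolution nrm_L1 integral_eq integrable_iff mult_ac)
    fix z
    show "(z \<odot>\<^bsub>L1 \<mu>\<^esub> X) \<otimes>\<^bsub>L1 \<mu>\<^esub> Y = z \<odot>\<^bsub>L1 \<mu>\<^esub> (X \<otimes>\<^bsub>L1 \<mu>\<^esub> Y)"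
      "X \<otimes>\<^bsub>L1 \<mu>\<^esub> (z \<odot>\<^bsub>L1 \<mu>\<^esub> Y) = z \<odot>\<^bsub>L1 \<mu>\<^esub> (X \<otimes>\<^bsub>L1 \<mu>\<^esub> Y)"
      using fg
      by (simp_all add: smult_L1 mult_L1_class integrable_convolution)
        (simp_all add: convolution_def[abs_def] mult.assoc mult.left_commute[of _ z])
  next
    fix X Y Z assume "X \<in> carrier (L1 \<mu>)" "Y \<in> carrier (L1 \<mu>)" "Z \<in> carrier (L1 \<mu>)"
    then obtain f g h where fgh: "integrable \<mu> f" "X = L1_class \<mu> f" "integrable \<mu> g" "Y = L1_class \<mu> g"
        "integrable \<mu> h" "Z = L1_class \<mu> h"
      by (metis in_carrier_L1E)
    show "X \<otimes>\<^bsub>L1 \<mu>\<^esub> Y \<otimes>\<^bsub>L1 \<mu>\<^esub> Z = X \<otimes>\<^bsub>L1 \<mu>\<^esub> (Y \<otimes>\<^bsub>L1 \<mu>\<^esub> Z)"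
      using fgh convolution_assoc[of f g h]
      by (simp add: mult_L1_class integrable_convolution integrable_iff[of f] integrable_iff[of g]
          integrable_iff[of h])
    show "(X \<oplus>\<^bsub>L1 \<mu>\<^esub> Y) \<otimes>\<^bsub>L1 \<mu>\<^esub> Z = X \<otimes>\<^bsub>L1 \<mu>\<^esub> Z \<oplus>\<^bsub>L1 \<mu>\<^esub> Y \<otimes>\<^bsub>L1 \<mu>\<^esub> Z"
      "X \<otimes>\<^bsub>L1 \<mu>\<^esub> (Y \<oplus>\<^bsub>L1 \<mu>\<^esub> Z) = X \<otimes>\<^bsub>L1 \<mu>\<^esub> Y \<oplus>\<^bsub>L1 \<mu>\<^esub> X \<otimes>\<^bsub>L1 \<mu>\<^esub> Z"
      using fgh
      by (simp_all add: add_L1 mult_L1_class integrable_convolution)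
        (simp_all add: convolution_def[abs_def] distrib_left distrib_right int)
  qed
qed

text \<open>The identity is the point mass at 0, expressed as a density with respect to \<mu>: a
  point has measure c, hence the value 1/c.\<close>

lemma convolution_unit:
  fixes f :: "'g \<Rightarrow> complex"
  defines "e \<equiv> \<lambda>x. if x = 0 then complex_of_real (1 / c) else 0"
  assumes "integrable \<mu> f"
  shows "integrable \<mu> e" "convolution \<mu> e f = f" "convolution \<mu> f e = f"
proof -
  have f: "(\<lambda>x. norm (f x)) summable_on UNIV"
    using assms integrable_iff by blast
  have e: "(\<lambda>x. norm (e x)) summable_on UNIV"
    by (rule has_sum_imp_summable, rule has_sum_finite_neutralI[of "{0}"]) (auto simp: e_def)
  then show "integrable \<mu> e"
    using integrable_iff by blast
  have "(\<Sum>\<^sub>\<infinity>y. e y * f (- y + x)) = f x / c" for x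
    by (rule infsumI, rule has_sum_finite_neutralI[of "{0}"]) (auto simp: e_def)
  then show "convolution \<mu> e f = f"
    using c_pos by (simp add: convolution_eq[OF e f] fun_eq_iff)
  have "(\<Sum>\<^sub>\<infinity>y. f y * e (- y + x)) = f x / c" for x
    by (rule infsumI, rule has_sum_finite_neutralI[of "{x}"])
      (auto simp: e_def neg_eq_iff_add_eq_0[symmetric])
  then show "convolution \<mu> f e = f"
    using c_pos by (simp add: convolution_eq[OF f e] fun_eq_iff)
qed

lemma zero_injective_L1: "zero_injective TYPE('u) (L1 \<mu>) (regular_module (L1 \<mu>))"
proof (rule zero_injective_of_identity[OF complex_banach_algebra_L1])
  let ?E = "L1_class \<mu> (\<lambda>x. if x = 0 then complex_of_real (1 / c) else 0)"
  show "?E \<in> carrier (L1 \<mu>)"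
    using convolution_unit(1)[of "\<lambda>_. 0"] by simp
  fix X assume "X \<in> carrier (L1 \<mu>)"
  then obtain f where "integrable \<mu> f" "X = L1_class \<mu> f"
    by (rule in_carrier_L1E)
  then show "?E \<otimes>\<^bsub>L1 \<mu>\<^esub> X = X" "X \<otimes>\<^bsub>L1 \<mu>\<^esub> ?E = X"
    using convolution_unit[of f] by (simp_all add: mult_L1_class)
qed

end

section \<open>Haar measure of a discrete group\<close>

text \<open>Points have the same mass by invariance. It is finite because points are compact and
  positive because they are open.\<close>

lemma (in haar) discrete_eq_scaled_counting:
  assumes discrete: "\<And>S :: 'g set. open S"
  obtains c where "scaled_counting \<mu> c"
proof -
  have fin: "emeasure \<mu> {0} < \<infinity>"
    by (rule compact_finite) simp
  have m: "emeasure \<mu> {0} = ennreal (measure \<mu> {0})"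
    using fin by (intro emeasure_eq_ennreal_measure) simp
  have pos: "0 < measure \<mu> {0}"
    using emeasure_open_pos[OF discrete[of "{0}"]] m by (simp add: zero_less_measure_iff)
  have sets: "A \<in> sets \<mu>" for A
    using discrete[of A] by simp
  have point: "emeasure \<mu> {a} = emeasure \<mu> {0}" for a
    using emeasure_translate[of "{0}" a] by simp
  have finite_sets: "emeasure \<mu> A = of_nat (card A) * emeasure \<mu> {0}" if "finite A" for A
  proof -
    have "emeasure \<mu> A = (\<Sum>a\<in>A. emeasure \<mu> {a})"
      using that sets by (intro emeasure_eq_sum_singleton)
    also have "\<dots> = (\<Sum>a\<in>A. emeasure \<mu> {0})"
      by (rule sum.cong[OF refl point])
    finally show ?thesis
      by simp
  qed
  have "\<mu> = density (count_space UNIV) (\<lambda>_. ennreal (measure \<mu> {0}))"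
  proof (rule measure_eqI)
    show "sets \<mu> = sets (density (count_space UNIV) (\<lambda>_. ennreal (measure \<mu> {0})))"
      using sets by auto
    fix A :: "'g set"
    have "emeasure \<mu> A = ennreal (measure \<mu> {0}) * emeasure (count_space UNIV) A"
    proof (cases "finite A")
      case True
      then show ?thesis
        by (simp add: finite_sets[OF True] m mult.commute)
    next
      case False
      \<comment> \<open>An infinite \<open>A\<close> may be uncountable, so its measure is not a
        countable sum over points; finite subsets of every size already force it to be
        infinite.\<close>
      have "of_nat n * emeasure \<mu> {0} \<le> emeasure \<mu> A" for n
      proof -
        obtain F where F: "F \<subseteq> A" "finite F" "card F = n"
          using infinite_arbitrarily_large[OF False] by blast
        then have "of_nat n * emeasure \<mu> {0} = emeasure \<mu> F"
          using finite_sets[OF F(2)] by simp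
        also have "\<dots> \<le> emeasure \<mu> A"
          using F sets by (intro emeasure_mono)
        finally show ?thesis .
      qed
      then have "(SUP n. of_nat n * emeasure \<mu> {0}) \<le> emeasure \<mu> A"
        by (intro SUP_least)
      moreover have "(SUP n. of_nat n * emeasure \<mu> {0}) = top_class.top"
        using pos m by (simp add: SUP_mult_right_ennreal[symmetric] ennreal_SUP_of_nat_eq_top ennreal_mult_eq_top_iff)
      ultimately have "emeasure \<mu> A = top_class.top"
        by (simp add: top_unique)
      then show ?thesis
        using False pos by (simp add: ennreal_mult_top)
    qed
    then show "emeasure \<mu> A = emeasure (density (count_space UNIV) (\<lambda>_. ennreal (measure \<mu> {0}))) A"
      by (subst emeasure_density) (auto simp: nn_integral_cmult_indicator)
  qed
  with pos have "scaled_counting \<mu> (measure \<mu> {0})"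
    by unfold_locales
  then show thesis
    by (rule that)
qed

theorem theorem3p7:
  fixes \<mu> :: "'g :: {topological_group_add, t2_space} measure"
    and j :: "('g \<Rightarrow> complex) set \<Rightarrow> 'u"
  assumes "locally_compact_space (euclidean :: 'g topology)"
    and "left_haar_measure \<mu>"
    and universe: "inj_on j (carrier (L1 \<mu>))"
  shows "zero_injective TYPE('u) (L1 \<mu>) (regular_module (L1 \<mu>)) \<longleftrightarrow>
    (euclidean :: 'g topology) = discrete_topology UNIV"
proof
  interpret haar \<mu>
    by unfold_locales (rule assms(2))
  assume zi: "zero_injective TYPE('u) (L1 \<mu>) (regular_module (L1 \<mu>))"
  then have alg: "complex_banach_algebra (L1 \<mu>)"
    by (simp add: zero_injective_def banach_left_module_def)
  \<comment> \<open>The universe is known to hold a copy of L1; squeezing L1 x C into L1 first makes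
    it hold the unitization too.\<close>
  obtain \<theta> :: "('g \<Rightarrow> complex) set \<times> complex \<Rightarrow> ('g \<Rightarrow> complex) set"
    where "inj_on \<theta> (carrier (L1 \<mu>) \<times> UNIV)" "\<theta> ` (carrier (L1 \<mu>) \<times> UNIV) \<subseteq> carrier (L1 \<mu>)"
    using inj_L1_times_complex by blast
  then have "inj_on (j \<circ> \<theta>) (carrier (L1 \<mu>) \<times> UNIV)"
    using universe by (intro comp_inj_on) (auto intro: inj_on_subset)
  from zero_injective_right_identity[OF zi this] obtain E where
    E: "E \<in> carrier (L1 \<mu>)" "\<And>X. X \<in> carrier (L1 \<mu>) \<Longrightarrow> X \<otimes>\<^bsub>L1 \<mu>\<^esub> E = X"
    by blast
  \<comment> \<open>Local compactness enters at the single point 0; translations spread the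
    conclusion over G.\<close>
  have "\<exists>W V. openin euclidean W \<and> compactin euclidean V \<and> (0 :: 'g) \<in> W \<and> W \<subseteq> V"
    using assms(1) unfolding locally_compact_space_def by simp
  then obtain W V :: "'g set" where "open W" "compact V" "0 \<in> W" "W \<subseteq> V"
    by auto
  then have "open {x}" for x :: 'g
    using open_singleton_of_right_identity[OF alg E] by blast
  then show "(euclidean :: 'g topology) = discrete_topology UNIV"
    by (subst eq_commute, subst discrete_topology_unique) auto
next
  interpret haar \<mu>
    by unfold_locales (rule assms(2))
  assume "(euclidean :: 'g topology) = discrete_topology UNIV"
  then have "open S" for S :: "'g set"
    by (metis open_openin openin_discrete_topology subset_UNIV)
  then obtain c where "scaled_counting \<mu> c"
    by (rule discrete_eq_scaled_counting)
  then show "zero_injective TYPE('u) (L1 \<mu>) (regular_module (L1 \<mu>))"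
    by (rule scaled_counting.zero_injective_L1)
qed

end
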